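(* Let $n\geq 6$ be an integer. Let $\mathcal{G}_1(n,n-3)$ be the set of connected graphs $G$ on $n$ vertices whose Laplacian spectrum is $\{[\alpha]^{n-3},[\beta]^{2},[0]^1\}$ for some reals $\alpha>\beta>0$, and let $\mathcal{G}_2(n,n-3)$ be the set of connected graphs $G$ on $n$ vertices whose Laplacian spectrum is $\{[\alpha]^{2},[\beta]^{n-3},[0]^1\}$ for some reals $\alpha>\beta>0$. Then: (i) $\mathcal{G}_1(n,n-3)=\{3K_1\nabla K_{n-3},\ C_4\nabla K_{n-4}\}$ (up to isomorphism), and their Laplacian spectra are $\mathrm{Spec}_L(3K_1\nabla K_{n-3})=\{[n]^{n-3},[n-3]^2,[0]^1\}$ and $\mathrm{Spec}_L(C_4\nabla K_{n-4})=\{[n]^{n-3},[n-2]^2,[0]^1\}$. (ii) $\mathcal{G}_2(n,n-3)=\{K_2\nabla(n-2)K_1,\ K_1\nabla K_{\frac{n-1}{2},\frac{n-1}{2}},\ K_{\frac{n}{3},\frac{n}{3},\frac{n}{3}}\}$ (up to isomorphism; the graph $K_1\nabla K_{\frac{n-1}{2},\frac{n-1}{2}}$ occurs only when $n$ is odd and $K_{\frac n3,\frac n3,\frac n3}$ only when $3\mid n$), and their Laplacian spectra are $\mathrm{Spec}_L(K_2\nabla(n-2)K_1)=\{[n]^2,[2]^{n-3},[0]^1\}$, $\mathrm{Spec}_L(K_1\nabla K_{\frac{n-1}{2},\frac{n-1}{2}})=\{[n]^2,[\frac{n+1}{2}]^{n-3},[0]^1\}$, and $\mathrm{Spec}_L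(K_{\frac{n}{3},\frac{n}{3},\frac{n}{3}})=\{[n]^2,[\frac{2n}{3}]^{n-3},[0]^1\}$.
   Context: All graphs are finite, simple and undirected. The Laplacian matrix of a graph $G$ is $L(G)=D(G)-A(G)$, where $D(G)$ is the diagonal matrix of vertex degrees and $A(G)$ the adjacency matrix; its eigenvalues are the Laplacian eigenvalues, and the multiset of them is the Laplacian spectrum $\mathrm{Spec}_L(G)$, written $\{[\lambda]^{m},\dots\}$ where $[\lambda]^m$ means $\lambda$ with multiplicity $m$. $K_m$ is the complete graph, $kK_1$ the edgeless graph on $k$ vertices, $C_4$ the 4-cycle, $K_{a,b}$ and $K_{a,b,c}$ complete bipartite and complete tripartite graphs. $G\nabla H$ denotes the join of $G$ and $H$: the disjoint union of $G$ and $H$ together with all edges between $V(G)$ and $V(H)$. *)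

theory Defs
  imports "Graph_Theory.Graph_Theory" "Jordan_Normal_Form.Char_Poly"
begin

text \<open>
  A finite simple undirected graph is a \<^locale>\<open>pair_graph\<close>: a finite vertex set with a symmetric,
  irreflexive set of ordered pairs, so that an edge is represented by both of its orientations.
\<close>

section \<open>The Laplacian spectrum\<close>

text \<open>
  Matrices are indexed by natural numbers, so the vertices are enumerated by an arbitrary
  repetition-free list. Another choice conjugates the matrices below by a permutation matrix and
  therefore leaves the spectrum unchanged.
\<close>

definition vertex_enum :: "'a pair_pre_digraph \<Rightarrow> 'a list" where
  "vertex_enum G = (SOME vs. distinct vs \<and> set vs = pverts G)"

definition degree_matrix :: "'a pair_pre_digraph \<Rightarrow> real mat" where
  "degree_matrix G = (let vs = vertex_enum G; n = card (pverts G) in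
     mat n n (\<lambda>(i, j). if i = j then real (out_degree G (vs ! i)) else 0))"

definition adjacency_matrix :: "'a pair_pre_digraph \<Rightarrow> real mat" where
  "adjacency_matrix G = (let vs = vertex_enum G; n = card (pverts G) in
     mat n n (\<lambda>(i, j). if (vs ! i, vs ! j) \<in> parcs G then 1 else 0))"

definition laplacian_matrix :: "'a pair_pre_digraph \<Rightarrow> real mat" where
  "laplacian_matrix G = degree_matrix G - adjacency_matrix G"

text \<open>
  \<^const>\<open>proots\<close> counts roots with multiplicity. Taking only the real roots loses nothing, as the
  Laplacian matrix of a graph is a real symmetric matrix.
\<close>

definition laplacian_spectrum :: "'a pair_pre_digraph \<Rightarrow> real multiset" where
  "laplacian_spectrum G = proots (char_poly (laplacian_matrix G))"

section \<open>Particular graphs and the join\<close>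

definition complete_pgraph :: "nat \<Rightarrow> nat pair_pre_digraph" where
  "complete_pgraph m =
     \<lparr>pverts = {..<m}, parcs = {(i, j). i < m \<and> j < m \<and> i \<noteq> j}\<rparr>"

definition edgeless_pgraph :: "nat \<Rightarrow> nat pair_pre_digraph" where
  "edgeless_pgraph k = \<lparr>pverts = {..<k}, parcs = {}\<rparr>"

text \<open>This is the cycle on \<open>m\<close> vertices for \<open>m \<ge> 3\<close> only.\<close>

definition cycle_pgraph :: "nat \<Rightarrow> nat pair_pre_digraph" where
  "cycle_pgraph m = \<lparr>pverts = {..<m},
     parcs = {(i, j). i < m \<and> j < m \<and> (j = Suc i mod m \<or> i = Suc j mod m)}\<rparr>"

text \<open>
  The vertex \<open>(i, j)\<close> is the \<open>j\<close>-th vertex of the \<open>i\<close>-th part; \<open>ps\<close> lists the sizes of the parts,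
  so \<open>[a, b]\<close> yields the complete bipartite and \<open>[a, b, c]\<close> the complete tripartite graph.
\<close>

definition complete_multipartite_pgraph :: "nat list \<Rightarrow> (nat \<times> nat) pair_pre_digraph" where
  "complete_multipartite_pgraph ps =
     (let V = {(i, j). i < length ps \<and> j < ps ! i} in
      \<lparr>pverts = V, parcs = {(u, v). u \<in> V \<and> v \<in> V \<and> fst u \<noteq> fst v}\<rparr>)"

definition graph_join ::
  "'a pair_pre_digraph \<Rightarrow> 'b pair_pre_digraph \<Rightarrow> ('a + 'b) pair_pre_digraph" (infixl "\<nabla>" 65) where
  "G \<nabla> H = \<lparr>pverts = pverts G <+> pverts H,
     parcs = map_prod Inl Inl ` parcs G \<union> map_prod Inr Inr ` parcs H
       \<union> (Inl ` pverts G) \<times> (Inr ` pverts H) \<union> (Inr ` pverts H) \<times> (Inl ` pverts G)\<rparr>"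

section \<open>The two classes of graphs\<close>

definition connected_graph_on :: "nat \<Rightarrow> 'a pair_pre_digraph \<Rightarrow> bool" where
  "connected_graph_on n G \<longleftrightarrow>
     pair_graph G \<and> Digraph_Component.connected G \<and> card (pverts G) = n"

definition G1_class :: "nat \<Rightarrow> 'a pair_pre_digraph set" where
  "G1_class n = {G. connected_graph_on n G \<and>
     (\<exists>\<alpha> \<beta>. \<alpha> > \<beta> \<and> \<beta> > 0 \<and>
        laplacian_spectrum G = replicate_mset (n - 3) \<alpha> + replicate_mset 2 \<beta> + {#0#})}"

definition G2_class :: "nat \<Rightarrow> 'a pair_pre_digraph set" where
  "G2_class n = {G. connected_graph_on n G \<and>
     (\<exists>\<alpha> \<beta>. \<alpha> > \<beta> \<and> \<beta> > 0 \<and>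
        laplacian_spectrum G = replicate_mset 2 \<alpha> + replicate_mset (n - 3) \<beta> + {#0#})}"

end

theory Submission
  imports Defs "Jordan_Normal_Form.Schur_Decomposition"
begin

text \<open>
  Let \<open>L\<close> be a Laplacian matrix with eigenvalues \<open>a\<close> (\<open>n - 3\<close> times), \<open>b\<close> (twice) and \<open>0\<close>; then
  \<open>(L - a)(L - b) = (ab/n) J\<close>. Up to a scalar, \<open>L - a + (a/n) J\<close> is a projection of rank 2, that is, the
  Gram matrix of \<open>n\<close> points in the plane. Off the diagonal it takes only two values, which for \<open>a, b \<noteq> n\<close>
  forces \<open>n \<le> 6\<close>, and \<open>n = 6\<close> is excluded by integrality. So \<open>n\<close> is an eigenvalue. If \<open>c\<close> is the other
  nonzero one, nonadjacent vertices have degree \<open>c\<close> and \<open>c\<close> common neighbours, hence equal neighbourhoods: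
  the graph is complete multipartite, with parts of size 1 or \<open>n - c\<close>. The multiplicities leave the listed cases.
\<close>

section \<open>Traces and triangular forms\<close>

text \<open>The spectrum is given only as a root multiset, so no eigenbasis is at hand. The
  constancy of \<open>(L - a)(L - b)\<close> then comes from a variance computation with these
  traces. The result is used as an equivalence: the spectrum holds iff degrees and common-neighbour
  counts satisfy three identities and the degree sum is the trace. It serves both to classify graphs
  and to compute the spectra of the listed ones.

  The bound 6 is 2 + 4: two vertices whose points form a basis, and at most one vertex for each of
  the four adjacency patterns to them.

  If the parts have size 1 or \<open>m\<close> and \<open>p\<close> vertices lie in parts of size
  \<open>m\<close>, the trace gives \<open>p (m - 1) = l m\<close>, where \<open>l\<close> is the
  multiplicity of \<open>n - m\<close>. With \<open>q = p / m\<close> parts this is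
  \<open>q (m - 1) = l\<close>: for \<open>l = 2\<close> the solutions are
  \<open>(q, m) = (1, 3), (2, 2)\<close>, and for \<open>l = n - 3\<close> the bound
  \<open>q m <= n\<close> leaves \<open>q = 1, 2, 3\<close>.\<close>

lemma proots_eq_imp_linear_factors:
  fixes p :: "'a :: field poly"
  assumes "proots p = mset es" "degree p = length es" "lead_coeff p = 1"
  shows "p = (\<Prod>e\<leftarrow>es. [:- e, 1:])"
  using assms
proof (induction es arbitrary: p)
  case Nil
  then show ?case by (auto elim!: degree_eq_zeroE simp: one_pCons)
next
  case (Cons e es)
  have p0: "p \<noteq> 0" using Cons.prems(3) by auto
  have "e \<in># proots p" using Cons.prems(1) by simp
  then have "poly p e = 0" using p0 by simp
  then obtain q where q: "p = [:- e, 1:] * q" by (metis dvdE poly_eq_0_iff_dvd)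
  have q0: "q \<noteq> 0" using p0 q by auto
  have "proots p = proots [:- e, 1:] + proots q" unfolding q using q0 by (intro proots_mult) auto
  then have "proots p = {#e#} + proots q" by simp
  then have 1: "proots q = mset es" using Cons.prems(1) by simp
  have "degree p = 1 + degree q" unfolding q using q0 by (subst degree_mult_eq) auto
  then have 2: "degree q = length es" using Cons.prems(2) by simp
  have 3: "lead_coeff q = 1" using Cons.prems(3) unfolding q lead_coeff_mult by simp
  show ?case using Cons.IH[OF 1 2 3] q by simp
qed

lemma proots_linear_factors:
  "proots (\<Prod>e\<leftarrow>es. [:- e, 1 :: 'a :: idom:]) = mset es"
proof (induction es)
  case (Cons e es)
  have "(\<Prod>e\<leftarrow>es. [:- e, 1:]) \<noteq> 0" by (auto simp: prod_list_zero_iff)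
  then have "proots ([:- e, 1:] * (\<Prod>e\<leftarrow>es. [:- e, 1:])) = {#e#} + mset es"
    using Cons by (subst proots_mult) auto
  then show ?case by simp
qed simp

text \<open>Converts a spectrum stated as a multiset into the factored form that
  \<open>schur_decomposition\<close> takes as input. A multiset of full size \<open>n\<close> forces
  the polynomial to split.\<close>

lemma proots_char_poly_eq_iff:
  fixes A :: "'a :: field mat"
  assumes A: "A \<in> carrier_mat n n" and len: "length es = n"
  shows "proots (char_poly A) = mset es \<longleftrightarrow> char_poly A = (\<Prod>e\<leftarrow>es. [:- e, 1:])"
  using proots_eq_imp_linear_factors[of "char_poly A" es] degree_monic_char_poly[OF A] len
  by (auto simp: proots_linear_factors)

definition mat_trace :: "'a :: comm_monoid_add mat \<Rightarrow> 'a" where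
  "mat_trace A = (\<Sum>i<dim_row A. A $$ (i, i))"

lemma index_mult_mat_sum:
  assumes "A \<in> carrier_mat n m" "B \<in> carrier_mat m k" "i < n" "j < k"
  shows "(A * B) $$ (i, j) = (\<Sum>l<m. A $$ (i, l) * B $$ (l, j))"
  using assms by (auto simp: scalar_prod_def atLeast0LessThan intro!: sum.cong)

lemma mat_trace_comm:
  fixes A :: "'a :: comm_semiring_0 mat"
  assumes "A \<in> carrier_mat n m" "B \<in> carrier_mat m n"
  shows "mat_trace (A * B) = mat_trace (B * A)"
proof -
  have "mat_trace (A * B) = (\<Sum>i<n. \<Sum>l<m. A $$ (i, l) * B $$ (l, i))"
    using assms by (auto simp: mat_trace_def index_mult_mat_sum intro!: sum.cong simp del: index_mult_mat(1))
  also have "\<dots> = (\<Sum>l<m. \<Sum>i<n. B $$ (l, i) * A $$ (i, l))"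
    by (subst sum.swap) (simp add: mult.commute)
  also have "\<dots> = mat_trace (B * A)"
    using assms by (auto simp: mat_trace_def index_mult_mat_sum intro!: sum.cong simp del: index_mult_mat(1))
  finally show ?thesis .
qed

lemma mat_trace_similar:
  fixes A :: "'a :: comm_semiring_1 mat"
  assumes "similar_mat_wit A B P Q" "A \<in> carrier_mat n n"
  shows "mat_trace A = mat_trace B"
proof -
  from similar_mat_witD2[OF assms(2,1)] have *: "Q * P = 1\<^sub>m n" "A = P * B * Q"
    "B \<in> carrier_mat n n" "P \<in> carrier_mat n n" "Q \<in> carrier_mat n n" by auto
  have "mat_trace A = mat_trace (Q * (P * B))"
    unfolding *(2) using * by (intro mat_trace_comm) auto
  also have "Q * (P * B) = (Q * P) * B" using * by (intro assoc_mult_mat[symmetric]) auto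
  finally show ?thesis using * by simp
qed

lemma mat_trace_upper_triangular:
  assumes "B \<in> carrier_mat n n" "upper_triangular B" "diag_mat B = es"
  shows "mat_trace B = sum_list es" "mat_trace (B * B) = (\<Sum>e\<leftarrow>es. e * (e :: 'a :: comm_semiring_0))"
proof -
  have es: "es = map (\<lambda>i. B $$ (i, i)) [0..<n]" using assms by (auto simp: diag_mat_def)
  show "mat_trace B = sum_list es"
    using assms(1) by (simp add: es mat_trace_def interv_sum_list_conv_sum_set_nat atLeast0LessThan)
  have "(B * B) $$ (i, i) = B $$ (i, i) * B $$ (i, i)" if i: "i < n" for i
  proof -
    \<comment> \<open>For \<open>l\<close> different from \<open>i\<close>, one of the two factors
      lies below the diagonal.\<close>
    have "B $$ (i, l) * B $$ (l, i) = 0" if "l < n" "l \<noteq> i" for l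
      using that i assms upper_triangularD[OF assms(2), of l i] upper_triangularD[OF assms(2), of i l]
      by (cases "l < i") auto
    then have "(\<Sum>l<n. B $$ (i, l) * B $$ (l, i)) = (\<Sum>l\<in>{i}. B $$ (i, l) * B $$ (l, i))"
      using i by (intro sum.mono_neutral_right) auto
    then show ?thesis using i assms by (subst index_mult_mat_sum) auto
  qed
  then have "mat_trace (B * B) = (\<Sum>i<n. B $$ (i, i) * B $$ (i, i))"
    using assms(1) by (auto simp: mat_trace_def intro!: sum.cong simp del: index_mult_mat(1))
  also have "\<dots> = (\<Sum>e\<leftarrow>es. e * e)"
    by (simp add: es o_def interv_sum_list_conv_sum_set_nat atLeast0LessThan)
  finally show "mat_trace (B * B) = (\<Sum>e\<leftarrow>es. e * e)" .
qed

text \<open>The Schur form is similar to \<open>A\<close> and carries \<open>es\<close> on its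
  diagonal; similarity preserves the traces of \<open>A\<close> and of its square.\<close>

lemma mat_trace_eigenvalues:
  fixes A :: "real mat"
  assumes A: "A \<in> carrier_mat n n" and c: "char_poly A = (\<Prod>e\<leftarrow>es. [:- e, 1:])"
  shows "mat_trace A = sum_list es" "mat_trace (A * A) = (\<Sum>e\<leftarrow>es. e * e)"
proof -
  obtain B P Q where "schur_decomposition A es = (B, P, Q)" by (metis prod_cases3)
  from schur_decomposition[OF A c this]
  have w: "similar_mat_wit A B P Q" and B: "upper_triangular B" "diag_mat B = es" by auto
  from similar_mat_witD2[OF A w] have *: "Q * P = 1\<^sub>m n" "P * Q = 1\<^sub>m n" "A = P * B * Q"
    "B \<in> carrier_mat n n" "P \<in> carrier_mat n n" "Q \<in> carrier_mat n n" by auto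
  have "A * A = A ^\<^sub>m 2" "B * B = B ^\<^sub>m 2" using A * by (auto simp: numeral_2_eq_2)
  then have w2: "similar_mat_wit (A * A) (B * B) P Q" using similar_mat_wit_pow[OF w, of 2] by simp
  show "mat_trace A = sum_list es"
    using mat_trace_similar[OF w A] mat_trace_upper_triangular[OF *(4) B] by simp
  show "mat_trace (A * A) = (\<Sum>e\<leftarrow>es. e * e)"
    using mat_trace_similar[OF w2, of n] A mat_trace_upper_triangular[OF *(4) B] by simp
qed

section \<open>Cayley-Hamilton from the triangular form\<close>

abbreviation shift_prod :: "'a :: field mat \<Rightarrow> 'a list \<Rightarrow> 'a mat" where
  "shift_prod A es \<equiv> foldl (\<lambda>X e. X * char_matrix A e) (1\<^sub>m (dim_row A)) es"

lemma shift_prod_carrier: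
  assumes "A \<in> carrier_mat n n" "X \<in> carrier_mat n n"
  shows "foldl (\<lambda>X e. X * char_matrix A e) X es \<in> carrier_mat n n"
  using assms(2) by (induction es arbitrary: X) (use assms(1) in auto)

text \<open>The factors must come in the order of the diagonal: after \<open>j\<close> of them the
  first \<open>j\<close> columns of the product vanish. Column \<open>j\<close> of the next factor
  is zero from the diagonal downwards, so it only combines columns that are zero already.\<close>

lemma shift_prod_upper_triangular:
  assumes B: "B \<in> carrier_mat n n" and ut: "upper_triangular B"
  shows "shift_prod B (diag_mat B) = 0\<^sub>m n n"
proof -
  let ?es = "diag_mat B"
  have len: "length ?es = n" using B by (simp add: diag_mat_def)
  have "\<forall>c<j. \<forall>i<n. shift_prod B (take j ?es) $$ (i, c) = 0" if "j \<le> n" for j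
    using that
  proof (induction j)
    case (Suc j)
    let ?X = "shift_prod B (take j ?es)"
    have X: "?X \<in> carrier_mat n n" using B by (intro shift_prod_carrier) auto
    have C: "char_matrix B (?es ! j) \<in> carrier_mat n n" using B by simp
    have step: "shift_prod B (take (Suc j) ?es) = ?X * char_matrix B (?es ! j)"
      using Suc.prems len by (simp add: take_Suc_conv_app_nth)
    show ?case
    proof (intro allI impI)
      fix c i assume c: "c < Suc j" and i: "i < n"
      have "?X $$ (i, l) * char_matrix B (?es ! j) $$ (l, c) = 0" if l: "l < n" for l
      proof (cases "l < j")
        case False
        have "char_matrix B (?es ! j) $$ (l, c) = 0"
          using False c l Suc.prems B upper_triangularD[OF ut, of c l]
          by (cases "l = c") (auto simp: char_matrix_def diag_mat_def less_Suc_eq)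
        then show ?thesis by simp
      qed (use Suc i l in simp)
      then show "shift_prod B (take (Suc j) ?es) $$ (i, c) = 0"
        unfolding step using c i Suc.prems
        by (subst index_mult_mat_sum[OF X C]) (auto intro!: sum.neutral simp del: mult_eq_0_iff)
    qed
  qed simp
  from this[of n] have "\<forall>c<n. \<forall>i<n. shift_prod B ?es $$ (i, c) = 0" using len by simp
  moreover have "shift_prod B ?es \<in> carrier_mat n n" using B by (intro shift_prod_carrier) auto
  ultimately show ?thesis by (intro eq_matI) auto
qed

lemma shift_prod_similar:
  assumes w: "similar_mat_wit A B P Q" and A: "A \<in> carrier_mat n n"
  shows "shift_prod A es = P * shift_prod B es * Q"
proof -
  from similar_mat_witD2[OF A w] have *: "Q * P = 1\<^sub>m n" "P * Q = 1\<^sub>m n" "A = P * B * Q"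
    "B \<in> carrier_mat n n" "P \<in> carrier_mat n n" "Q \<in> carrier_mat n n" by auto
  have cm: "char_matrix A e = P * char_matrix B e * Q" for e
  proof -
    have "P * char_matrix B e * Q = P * B * Q + P * ((- e) \<cdot>\<^sub>m 1\<^sub>m n) * Q"
      using * by (simp add: char_matrix_def mult_add_distrib_mat[of _ n n _ n] add_mult_distrib_mat[of _ n n _ _ n])
    also have "P * ((- e) \<cdot>\<^sub>m 1\<^sub>m n) * Q = (- e) \<cdot>\<^sub>m (P * Q)"
      using * by (simp add: mult_smult_distrib[of _ n n _ n] mult_smult_assoc_mat[of _ n n _ n])
    finally show ?thesis using * A by (simp add: char_matrix_def)
  qed
  \<comment> \<open>Generalised over the accumulator \<open>X\<close>, which the left fold changes;
    every step cancels one inner \<open>Q * P\<close>.\<close>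
  have "foldl (\<lambda>X e. X * char_matrix A e) (P * X * Q) es = P * foldl (\<lambda>X e. X * char_matrix B e) X es * Q"
    if "X \<in> carrier_mat n n" for X
    using that
  proof (induction es arbitrary: X)
    case (Cons e es)
    have C: "char_matrix B e \<in> carrier_mat n n" using * by simp
    have "P * X * Q * char_matrix A e = P * X * ((Q * P) * (char_matrix B e * Q))"
      unfolding cm using * C Cons.prems
      by (smt (verit) assoc_mult_mat mult_carrier_mat)
    also have "\<dots> = P * (X * char_matrix B e) * Q"
      unfolding *(1) using * C Cons.prems by (smt (verit) assoc_mult_mat left_mult_one_mat mult_carrier_mat)
    finally have eq: "P * X * Q * char_matrix A e = P * (X * char_matrix B e) * Q" .
    have "X * char_matrix B e \<in> carrier_mat n n" using Cons.prems C by simp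
    from Cons.IH[OF this] show ?case by (simp add: eq)
  qed simp
  from this[of "1\<^sub>m n"] show ?thesis using * A by simp
qed

text \<open>Cayley-Hamilton for a split characteristic polynomial, kept as a product of linear
  factors so that single factors can be removed later.\<close>

lemma shift_prod_eigenvalues:
  fixes A :: "real mat"
  assumes A: "A \<in> carrier_mat n n" and c: "char_poly A = (\<Prod>e\<leftarrow>es. [:- e, 1:])"
  shows "shift_prod A es = 0\<^sub>m n n"
proof -
  obtain B P Q where "schur_decomposition A es = (B, P, Q)" by (metis prod_cases3)
  from schur_decomposition[OF A c this]
  have w: "similar_mat_wit A B P Q" and B: "upper_triangular B" "diag_mat B = es" by auto
  from similar_mat_witD2[OF A w]
  have "B \<in> carrier_mat n n" "P \<in> carrier_mat n n" "Q \<in> carrier_mat n n" by auto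
  then show ?thesis
    using shift_prod_similar[OF w A, of es] shift_prod_upper_triangular[of B n] B by simp
qed

lemma shift_prod_replicate:
  assumes "X \<in> carrier_mat n n" "A \<in> carrier_mat n n"
  shows "foldl (\<lambda>X e. X * char_matrix A e) X (replicate k a) = X * char_matrix A a ^\<^sub>m k"
proof (induction k)
  case 0
  have "dim_row (char_matrix A a) = n" using char_matrix_closed[OF assms(2)] by blast
  then show ?case using assms by simp
next
  case (Suc k)
  have C: "char_matrix A a \<in> carrier_mat n n" using assms by simp
  have "foldl (\<lambda>X e. X * char_matrix A e) X (replicate (Suc k) a) =
        foldl (\<lambda>X e. X * char_matrix A e) X (replicate k a @ [a])"
    by (simp add: replicate_append_same)
  also have "\<dots> = X * char_matrix A a ^\<^sub>m k * char_matrix A a" using Suc by simp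
  also have "\<dots> = X * char_matrix A a ^\<^sub>m Suc k" using assms C by (simp add: assoc_mult_mat[of _ n n _ n _ n])
  finally show ?case .
qed

text \<open>The Gram matrix of the columns of \<open>S * Y\<close> is \<open>Y^T S S Y = 0\<close>,
  and its diagonal entries are the squared column norms. This replaces diagonalisability: a repeated
  symmetric factor can be reduced to a single one.\<close>

lemma symmetric_square_mult_zero:
  fixes S :: "real mat"
  assumes S: "S \<in> carrier_mat n n" "transpose_mat S = S" and Y: "Y \<in> carrier_mat n m"
    and 0: "S * (S * Y) = 0\<^sub>m n m"
  shows "S * Y = 0\<^sub>m n m"
proof (rule eq_matI)
  have T: "transpose_mat (S * Y) * (S * Y) = transpose_mat Y * (S * (S * Y))"
    using S Y by (simp add: transpose_mult[OF S(1) Y] assoc_mult_mat[of _ m n _ n _ m])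
  fix i j assume ij: "i < dim_row (0\<^sub>m n m)" "j < dim_col (0\<^sub>m n m)"
  have "(transpose_mat (S * Y) * (S * Y)) $$ (j, j) = (\<Sum>l<n. (S * Y) $$ (l, j) * (S * Y) $$ (l, j))"
    using S Y ij by (subst index_mult_mat_sum[of _ m n _ m]) (auto intro!: sum.cong)
  moreover have "(transpose_mat (S * Y) * (S * Y)) $$ (j, j) = 0"
    unfolding T 0 using Y ij by simp
  ultimately have "\<forall>l\<in>{..<n}. (S * Y) $$ (l, j) * (S * Y) $$ (l, j) = 0"
    by (subst sum_nonneg_eq_0_iff[symmetric]) auto
  then show "(S * Y) $$ (i, j) = 0\<^sub>m n m $$ (i, j)" using ij by auto
qed (use S Y in auto)

lemma symmetric_pow_mult_zero:
  fixes S :: "real mat"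
  assumes S: "S \<in> carrier_mat n n" "transpose_mat S = S" and Y: "Y \<in> carrier_mat n m"
    and 0: "S ^\<^sub>m k * Y = 0\<^sub>m n m" and k: "k > 0"
  shows "S * Y = 0\<^sub>m n m"
  using Y 0 k
proof (induction k arbitrary: Y)
  case (Suc k)
  show ?case
  proof (cases "k = 0")
    case False
    have "S ^\<^sub>m k * (S * Y) = 0\<^sub>m n m"
      using Suc.prems S by (simp add: assoc_mult_mat[of _ n n _ n _ m])
    with Suc.IH[of "S * Y"] False S Suc.prems have "S * (S * Y) = 0\<^sub>m n m" by simp
    then show ?thesis using symmetric_square_mult_zero S Suc.prems by blast
  qed (use Suc.prems S in simp)
qed simp

section \<open>Symmetric matrices with two nonzero eigenvalues\<close>

text \<open>The product \<open>(A - a)(A - b)\<close>, expanded so that its entries and its symmetry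
  can be read off.\<close>

definition quad_mat :: "'a :: comm_ring_1 mat \<Rightarrow> 'a \<Rightarrow> 'a \<Rightarrow> 'a mat" where
  "quad_mat A a b = A * A + (- (a + b)) \<cdot>\<^sub>m A + (a * b) \<cdot>\<^sub>m 1\<^sub>m (dim_row A)"

lemma quad_mat_carrier [simp]: "A \<in> carrier_mat n n \<Longrightarrow> quad_mat A a b \<in> carrier_mat n n"
  by (auto simp: quad_mat_def)

lemma char_matrix_mult:
  assumes A: "A \<in> carrier_mat n n"
  shows "char_matrix A a * char_matrix A b = quad_mat A a (b :: 'a :: field)"
proof (rule eq_matI)
  fix i j assume "i < dim_row (quad_mat A a b)" "j < dim_col (quad_mat A a b)"
  then have ij: "i < n" "j < n" using quad_mat_carrier[OF A, of a b] by auto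
  have "(char_matrix A a * char_matrix A b) $$ (i, j) =
      (\<Sum>l<n. (A $$ (i, l) + (if i = l then - a else 0)) * (A $$ (l, j) + (if l = j then - b else 0)))"
    using A ij
    by (subst index_mult_mat_sum[of _ n n _ n]) (auto simp: char_matrix_def intro!: sum.cong)
  also have "\<dots> = (\<Sum>l<n. A $$ (i, l) * A $$ (l, j) + (if l = i then - a * A $$ (l, j) else 0)
      + (if l = j then - b * A $$ (i, l) else 0) + (if l = i then if i = j then a * b else 0 else 0))"
    by (rule sum.cong) (auto simp: algebra_simps)
  also have "\<dots> = (A * A) $$ (i, j) - (a + b) * A $$ (i, j) + (if i = j then a * b else 0)"
    using A ij by (auto simp: sum.distrib index_mult_mat_sum[of _ n n _ n] algebra_simps simp del: index_mult_mat)
  also have "\<dots> = quad_mat A a b $$ (i, j)"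
    using A ij by (auto simp: quad_mat_def algebra_simps)
  finally show "(char_matrix A a * char_matrix A b) $$ (i, j) = quad_mat A a b $$ (i, j)" .
qed (use A in \<open>auto simp: char_matrix_def quad_mat_def\<close>)

lemma transpose_pow_symmetric:
  fixes S :: "'a :: comm_semiring_1 mat"
  assumes S: "S \<in> carrier_mat n n" "transpose_mat S = S"
  shows "transpose_mat (S ^\<^sub>m k) = S ^\<^sub>m k"
proof (induction k)
  case (Suc k)
  have "S * S ^\<^sub>m k = S ^\<^sub>m k * S"
    by (induction k) (use S in \<open>auto simp: assoc_mult_mat[of _ n n _ n _ n, symmetric]\<close>)
  then show ?case using Suc S by (simp add: transpose_mult[of _ n n _ n])
qed (use S in simp)

lemma transpose_char_matrix_symmetric:
  fixes A :: "'a :: field mat"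
  assumes "A \<in> carrier_mat n n" "transpose_mat A = A"
  shows "transpose_mat (char_matrix A e) = char_matrix A e"
proof (rule eq_matI)
  fix i j assume "i < dim_row (char_matrix A e)" "j < dim_col (char_matrix A e)"
  then have ij: "i < n" "j < n" using char_matrix_closed[OF assms(1), of e] by auto
  have "A $$ (i, j) = A $$ (j, i)" using ij assms index_transpose_mat(1)[of i A j] by auto
  then show "transpose_mat (char_matrix A e) $$ (i, j) = char_matrix A e $$ (i, j)"
    using ij assms(1) by (auto simp: char_matrix_def)
qed (use char_matrix_closed[OF assms(1), of e] in auto)

text \<open>The eigenvalue 0 is listed between the two blocks so that each power in
  \<open>Ca^k A Cb^l = 0\<close> stands at one end. The left power is reduced to a single factor
  directly, the right one after transposing the equation.\<close>

lemma symmetric_annihilated: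
  fixes A :: "real mat"
  assumes A: "A \<in> carrier_mat n n" "transpose_mat A = A"
    and c: "char_poly A = (\<Prod>e\<leftarrow>replicate k a @ 0 # replicate l b. [:- e, 1:])"
    and kl: "k > 0" "l > 0"
  shows "A * quad_mat A a b = 0\<^sub>m n n"
proof -
  define Ca Cb where "Ca = char_matrix A a" and "Cb = char_matrix A b"
  have C [simp]: "Ca \<in> carrier_mat n n" "Cb \<in> carrier_mat n n" "transpose_mat Ca = Ca" "transpose_mat Cb = Cb"
    using A transpose_char_matrix_symmetric[OF A] by (auto simp: Ca_def Cb_def)
  have A0: "char_matrix A 0 = A" using A by (auto simp: char_matrix_def)
  have P [simp]: "Ca ^\<^sub>m k \<in> carrier_mat n n" "Cb ^\<^sub>m l \<in> carrier_mat n n"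
    "transpose_mat (Cb ^\<^sub>m l) = Cb ^\<^sub>m l"
    using C transpose_pow_symmetric[of Cb n l] by auto
  have "0\<^sub>m n n = shift_prod A (replicate k a @ 0 # replicate l b)"
    using shift_prod_eigenvalues[OF A(1) c] by simp
  also have "\<dots> = Ca ^\<^sub>m k * A * Cb ^\<^sub>m l"
  proof -
    have 1: "foldl (\<lambda>X e. X * char_matrix A e) (1\<^sub>m n) (replicate k a) = 1\<^sub>m n * Ca ^\<^sub>m k"
      unfolding Ca_def by (rule shift_prod_replicate) (use A in auto)
    have 2: "foldl (\<lambda>X e. X * char_matrix A e) (Ca ^\<^sub>m k * A) (replicate l b) = Ca ^\<^sub>m k * A * Cb ^\<^sub>m l"
      unfolding Cb_def by (rule shift_prod_replicate) (use A mult_carrier_mat[OF P(1) A(1)] in auto)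
    have 3: "1\<^sub>m n * Ca ^\<^sub>m k = Ca ^\<^sub>m k" using P(1) by (rule left_mult_one_mat)
    have "dim_row A = n" using A by auto
    then show ?thesis by (simp only: foldl_append 1 3 foldl_Cons A0 2)
  qed
  finally have "Ca ^\<^sub>m k * (A * Cb ^\<^sub>m l) = 0\<^sub>m n n"
    using A P mult_carrier_mat[OF P(1) A(1)] by (simp add: assoc_mult_mat[of _ n n _ n _ n])
  then have "Ca * (A * Cb ^\<^sub>m l) = 0\<^sub>m n n"
    using symmetric_pow_mult_zero[of Ca n "A * Cb ^\<^sub>m l" n k] A kl by simp
  then have "transpose_mat (Ca * (A * Cb ^\<^sub>m l)) = 0\<^sub>m n n" by simp
  also have "transpose_mat (Ca * (A * Cb ^\<^sub>m l)) = Cb ^\<^sub>m l * (A * Ca)"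
    using A by (simp add: transpose_mult[of _ n n _ n] assoc_mult_mat[of _ n n _ n _ n])
  finally have "Cb * (A * Ca) = 0\<^sub>m n n"
    using symmetric_pow_mult_zero[of Cb n "A * Ca" n l] A kl by simp
  moreover have "Cb * A = A * Cb"
    using char_matrix_mult[OF A(1), of b 0] char_matrix_mult[OF A(1), of 0 b]
    by (simp add: A0 Cb_def quad_mat_def)
  ultimately have "A * (Cb * Ca) = 0\<^sub>m n n"
    using A by (simp add: assoc_mult_mat[of _ n n _ n _ n, symmetric])
  then show ?thesis
    using char_matrix_mult[OF A(1), of b a] by (simp add: Ca_def Cb_def quad_mat_def add.commute mult.commute)
qed

text \<open>Write \<open>R\<close> for \<open>quad_mat A a b\<close>. From
  \<open>A * R = R * A = 0\<close> follows \<open>R * R = a b R\<close>. The traces of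
  \<open>A\<close> and its square give \<open>R\<close> the trace \<open>a b\<close> (only the
  eigenvalue 0 contributes), hence the squared entries of the symmetric \<open>R\<close> sum to
  \<open>(a b)^2\<close>. As the rows of \<open>A\<close> sum to 0, each row of \<open>R\<close>
  sums to \<open>a b\<close>. The entries thus have squared deviation 0 from
  \<open>a b / n\<close>.\<close>

lemma quad_mat_const:
  fixes A :: "real mat"
  assumes A: "A \<in> carrier_mat n n" "transpose_mat A = A"
    and row: "\<And>i. i < n \<Longrightarrow> (\<Sum>j<n. A $$ (i, j)) = 0"
    and spec: "proots (char_poly A) = replicate_mset k a + replicate_mset l b + {#0#}"
    and kl: "k > 0" "l > 0" "n = k + l + 1"
    and ij: "i < n" "j < n"
  shows "quad_mat A a b $$ (i, j) = a * b / n" "mat_trace A = k * a + l * b"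
proof -
  let ?es = "replicate k a @ 0 # replicate l b"
  have "proots (char_poly A) = mset ?es" using spec by simp
  then have c: "char_poly A = (\<Prod>e\<leftarrow>?es. [:- e, 1:])"
    using proots_char_poly_eq_iff[OF A(1), of ?es] kl by simp
  show tr: "mat_trace A = k * a + l * b"
    using mat_trace_eigenvalues(1)[OF A(1) c] by (simp add: sum_list_replicate)
  have tr2: "mat_trace (A * A) = k * (a * a) + l * (b * b)"
    using mat_trace_eigenvalues(2)[OF A(1) c] by (simp add: sum_list_replicate)
  define R where "R = quad_mat A a b"
  have R: "R \<in> carrier_mat n n" using A by (simp add: R_def)
  have AR: "A * R = 0\<^sub>m n n" using symmetric_annihilated[OF A c kl(1,2)] by (simp add: R_def)
  have RT: "transpose_mat R = R"
  proof -
    have smult: "transpose_mat (c \<cdot>\<^sub>m X) = c \<cdot>\<^sub>m transpose_mat X" for c :: real and X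
      by (rule eq_matI) auto
    show ?thesis
      using A by (simp add: R_def quad_mat_def transpose_add[of _ n n] transpose_mult[of _ n n _ n] smult)
  qed
  have "R * A = transpose_mat (A * R)" using A R RT by (simp add: transpose_mult[of _ n n _ n])
  then have RA: "R * A = 0\<^sub>m n n" by (simp add: AR)
  have "R * R = R * (A * A) + R * ((- (a + b)) \<cdot>\<^sub>m A) + R * ((a * b) \<cdot>\<^sub>m 1\<^sub>m n)"
    using A R by (subst (2) R_def) (simp add: quad_mat_def mult_add_distrib_mat[of _ n n _ n])
  also have "R * (A * A) = 0\<^sub>m n n"
    using A R RA by (simp add: assoc_mult_mat[of _ n n _ n _ n, symmetric])
  finally have RR: "R * R = (a * b) \<cdot>\<^sub>m R"
    using A R RA by (simp add: mult_smult_distrib[of _ n n _ n])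
  have idx: "R $$ (i, j) = (A * A) $$ (i, j) - (a + b) * A $$ (i, j) + (if i = j then a * b else 0)"
    if "i < n" "j < n" for i j
    using that A by (auto simp: R_def quad_mat_def algebra_simps)
  have sym: "R $$ (i, j) = R $$ (j, i)" if "i < n" "j < n" for i j
    using that R RT index_transpose_mat(1)[of i R j] by auto
  have trR: "mat_trace R = a * b"
  proof -
    have "mat_trace R = mat_trace (A * A) - (a + b) * mat_trace A + n * (a * b)"
      using A R idx by (simp add: mat_trace_def sum.distrib sum_subtractf sum_distrib_left del: index_mult_mat(1))
    then show ?thesis by (simp add: tr tr2 kl algebra_simps)
  qed
  have rowR: "(\<Sum>j<n. R $$ (i, j)) = a * b" if i: "i < n" for i
  proof -
    have "(\<Sum>j<n. (A * A) $$ (i, j)) = (\<Sum>j<n. \<Sum>l<n. A $$ (i, l) * A $$ (l, j))"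
      using A i by (auto simp: index_mult_mat_sum[of _ n n _ n] simp del: index_mult_mat intro!: sum.cong)
    also have "\<dots> = (\<Sum>l<n. A $$ (i, l) * (\<Sum>j<n. A $$ (l, j)))"
      by (subst sum.swap) (simp add: sum_distrib_left)
    also have "\<dots> = 0" by (simp add: row)
    finally have "(\<Sum>j<n. (A * A) $$ (i, j)) = 0" .
    then show ?thesis
      using i row[OF i]
      by (simp add: idx sum.distrib sum_subtractf flip: sum_distrib_left del: index_mult_mat(1))
  qed
  have sq: "(\<Sum>i<n. \<Sum>j<n. R $$ (i, j) * R $$ (i, j)) = a * b * (a * b)"
  proof -
    have "(\<Sum>i<n. \<Sum>j<n. R $$ (i, j) * R $$ (i, j)) = mat_trace (R * R)"
      using R sym by (auto simp: mat_trace_def index_mult_mat_sum[of _ n n _ n] intro!: sum.cong simp del: index_mult_mat(1))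
    also have "\<dots> = a * b * mat_trace R"
      using R by (auto simp: RR mat_trace_def sum_distrib_left)
    finally show ?thesis by (simp add: trR)
  qed
  define c where "c = a * b / n"
  have n: "real n > 0" using kl by simp
  have "(\<Sum>i<n. \<Sum>j<n. (R $$ (i, j) - c)\<^sup>2) =
      (\<Sum>i<n. \<Sum>j<n. R $$ (i, j) * R $$ (i, j)) - 2 * c * (\<Sum>i<n. \<Sum>j<n. R $$ (i, j)) + n * (n * c\<^sup>2)"
    by (simp add: power2_eq_square algebra_simps sum.distrib sum_subtractf sum_distrib_left)
  also have "\<dots> = 0" using n by (simp add: sq rowR c_def power2_eq_square field_simps)
  finally have "\<forall>i\<in>{..<n}. (\<Sum>j<n. (R $$ (i, j) - c)\<^sup>2) = 0"
    by (subst sum_nonneg_eq_0_iff[symmetric]) (auto intro: sum_nonneg)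
  then have "(\<Sum>j<n. (R $$ (i, j) - c)\<^sup>2) = 0" using ij by simp
  then have "\<forall>j\<in>{..<n}. (R $$ (i, j) - c)\<^sup>2 = 0"
    by (subst sum_nonneg_eq_0_iff[symmetric]) auto
  then show "quad_mat A a b $$ (i, j) = a * b / n" using ij by (simp add: R_def c_def)
qed

text \<open>The differences \<open>x - k\<close> and \<open>y - l\<close> solve a homogeneous linear
  system with determinant \<open>a b (b - a)\<close>, which is nonzero.\<close>

lemma three_multiplicities:
  fixes a b :: real and k l x y z :: nat
  assumes ab: "a \<noteq> 0" "b \<noteq> 0" "a \<noteq> b"
    and "x + y + z = k + l + 1" "x * a + y * b = k * a + l * b"
      "x * (a * a) + y * (b * b) = k * (a * a) + l * (b * b)"
  shows "x = k \<and> y = l \<and> z = 1"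
proof -
  have 1: "(real x - k) * a = - ((real y - l) * b)" using assms(5) by (simp add: algebra_simps)
  have 2: "(real x - k) * a * a + (real y - l) * b * b = 0" using assms(6) by (simp add: algebra_simps)
  have "(real y - l) * b * (b - a) = 0" using 2 unfolding 1 by (simp add: algebra_simps)
  then have "real y = l" using ab by simp
  moreover from this 1 ab have "real x = k" by simp
  ultimately show ?thesis using assms(4) by simp
qed

text \<open>
  All complex eigenvalues lie in \<open>{0, a, b}\<close>, and the traces of \<open>A\<close> and \<open>A\<^sup>2\<close> determine their multiplicities.
\<close>

lemma spectrum_of_quad_mat:
  fixes A :: "real mat"
  assumes A: "A \<in> carrier_mat n n"
    and row: "\<And>i. i < n \<Longrightarrow> (\<Sum>j<n. A $$ (i, j)) = 0"
    and q: "\<And>i j. i < n \<Longrightarrow> j < n \<Longrightarrow> quad_mat A a b $$ (i, j) = a * b / n"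
    and tr: "mat_trace A = k * a + l * b"
    and ab: "a \<noteq> 0" "b \<noteq> 0" "a \<noteq> b" and n: "n = k + l + 1"
  shows "proots (char_poly A) = replicate_mset k a + replicate_mset l b + {#0#}"
proof -
  define c where "c = a * b / n"
  have A2: "(A * A) $$ (i, j) = (a + b) * A $$ (i, j) - (if i = j then a * b else 0) + c"
    if "i < n" "j < n" for i j
    using q[OF that] that A by (auto simp: quad_mat_def c_def algebra_simps)
  have tr2: "mat_trace (A * A) = k * (a * a) + l * (b * b)"
  proof -
    have "mat_trace (A * A) = (a + b) * mat_trace A - n * (a * b) + n * c"
      using A A2 by (simp add: mat_trace_def sum.distrib sum_subtractf sum_distrib_left del: index_mult_mat(1))
    also have "n * c = a * b" using n by (simp add: c_def)
    finally show ?thesis using n by (simp add: tr algebra_simps)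
  qed
  \<comment> \<open>This is \<open>A(A - a)(A - b) = 0\<close>: the constant matrix on the right of
    the quadratic equation is killed by \<open>A\<close>, whose rows sum to 0.\<close>
  have A3: "A * (A * A) = (a + b) \<cdot>\<^sub>m (A * A) - (a * b) \<cdot>\<^sub>m A"
  proof (rule eq_matI)
    fix i j assume "i < dim_row ((a + b) \<cdot>\<^sub>m (A * A) - (a * b) \<cdot>\<^sub>m A)"
      "j < dim_col ((a + b) \<cdot>\<^sub>m (A * A) - (a * b) \<cdot>\<^sub>m A)"
    then have ij: "i < n" "j < n" using A by auto
    have "(A * (A * A)) $$ (i, j) = (\<Sum>l<n. A $$ (i, l) * (A * A) $$ (l, j))"
      using A ij by (subst index_mult_mat_sum[of _ n n _ n]) auto
    also have "\<dots> = (\<Sum>l<n. (a + b) * (A $$ (i, l) * A $$ (l, j)) - (if l = j then a * b * A $$ (i, j) else 0)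
        + A $$ (i, l) * c)"
      using ij by (intro sum.cong) (auto simp: A2 algebra_simps simp del: index_mult_mat(1))
    also have "\<dots> = (a + b) * (\<Sum>l<n. A $$ (i, l) * A $$ (l, j)) - a * b * A $$ (i, j)"
      using ij row[OF ij(1)] by (simp add: sum.distrib sum_subtractf flip: sum_distrib_left sum_distrib_right)
    also have "(\<Sum>l<n. A $$ (i, l) * A $$ (l, j)) = (A * A) $$ (i, j)"
      using A ij by (subst index_mult_mat_sum[of _ n n _ n]) auto
    finally show "(A * (A * A)) $$ (i, j) = ((a + b) \<cdot>\<^sub>m (A * A) - (a * b) \<cdot>\<^sub>m A) $$ (i, j)"
      using A ij by simp
  qed (use A in auto)
  \<comment> \<open>The characteristic polynomial splits over the complex numbers, so each root has
    an eigenvector to which the cubic identity applies.\<close>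
  let ?c = "complex_of_real" let ?C = "map_mat complex_of_real A"
  have C: "?C \<in> carrier_mat n n" using A by simp
  obtain zs where zs: "char_poly ?C = (\<Prod>z\<leftarrow>zs. [:- z, 1:])" "length zs = n"
    using char_poly_factorized[OF C] by blast
  have root: "z \<in> {0, ?c a, ?c b}" if "z \<in> set zs" for z
  proof -
    have "poly (char_poly ?C) z = 0" using that zs by (auto simp: poly_prod_list prod_list_zero_iff image_iff)
    then have "eigenvalue ?C z" using eigenvalue_root_char_poly[OF C] by simp
    then obtain v where v: "v \<in> carrier_vec n" "v \<noteq> 0\<^sub>v n" "?C *\<^sub>v v = z \<cdot>\<^sub>v v"
      unfolding eigenvalue_def eigenvector_def using C by auto
    have C2: "(?C * ?C) *\<^sub>v v = (z * z) \<cdot>\<^sub>v v"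
      using C v by (simp add: mult_mat_vec[of _ n n] smult_smult_assoc)
    have C3: "(?C * (?C * ?C)) *\<^sub>v v = (z * z * z) \<cdot>\<^sub>v v"
      using C v C2 by (simp add: assoc_mult_mat_vec[of _ n n _ n] mult_mat_vec[of _ n n] smult_smult_assoc)
    have "?C * (?C * ?C) = map_mat ?c (A * (A * A))"
      using A by (simp add: of_real_hom.mat_hom_mult[of _ n n _ n])
    also have "\<dots> = ?c (a + b) \<cdot>\<^sub>m (?C * ?C) - ?c (a * b) \<cdot>\<^sub>m ?C"
      unfolding A3 using A
      by (intro eq_matI) (auto simp: of_real_hom.mat_hom_mult[of A n n A n, symmetric])
    finally have "(z * z * z) \<cdot>\<^sub>v v = (?c (a + b) \<cdot>\<^sub>m (?C * ?C) - ?c (a * b) \<cdot>\<^sub>m ?C) *\<^sub>v v"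
      using C3 by simp
    also have "\<dots> = ?c (a + b) \<cdot>\<^sub>v ((z * z) \<cdot>\<^sub>v v) - ?c (a * b) \<cdot>\<^sub>v (z \<cdot>\<^sub>v v)"
    proof -
      have "(x \<cdot>\<^sub>m X) *\<^sub>v v = x \<cdot>\<^sub>v (X *\<^sub>v v)" if "X \<in> carrier_mat n n" for x and X :: "complex mat"
        using that v(1) by (intro eq_vecI) auto
      then show ?thesis
        using C v(1,3) C2 by (simp add: minus_mult_distrib_mat_vec[of _ n n] del: assoc_mult_mat_vec)
    qed
    finally have e: "(z * z * z) \<cdot>\<^sub>v v = ?c (a + b) \<cdot>\<^sub>v ((z * z) \<cdot>\<^sub>v v) - ?c (a * b) \<cdot>\<^sub>v (z \<cdot>\<^sub>v v)" .
    obtain i where i: "i < n" "v $ i \<noteq> 0" using v(1,2) by (metis carrier_vecD eq_vecI index_zero_vec)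
    have "(z * z * z) * v $ i = ?c (a + b) * (z * z * v $ i) - ?c (a * b) * (z * v $ i)"
      using arg_cong[OF e, of "\<lambda>w. w $ i"] v(1) i by simp
    then have "(z * (z - ?c a) * (z - ?c b)) * v $ i = 0" by (simp add: algebra_simps)
    then show ?thesis using i by auto
  qed
  \<comment> \<open>All roots turned out to be real, so the factorisation descends to the reals
    because the embedding of polynomials is injective.\<close>
  define es where "es = map Re zs"
  have zs_es: "zs = map ?c es" using root by (fastforce simp: es_def intro!: map_idI[symmetric])
  interpret h: map_poly_inj_idom_hom ?c ..
  have "map_poly ?c (char_poly A) = char_poly ?C" by (simp add: of_real_hom.char_poly_hom[OF A])
  also have "\<dots> = map_poly ?c (\<Prod>e\<leftarrow>es. [:- e, 1:])"
    unfolding zs zs_es by (simp add: h.hom_prod_list o_def)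
  finally have c: "char_poly A = (\<Prod>e\<leftarrow>es. [:- e, 1:])"
    by (rule h.injectivity)
  have mem: "set es \<subseteq> {0, a, b}" using root by (fastforce simp: es_def)
  define x y z where "x = count (mset es) a" and "y = count (mset es) b" and "z = count (mset es) 0"
  have "length es = x + y + z \<and> sum_list es = x * a + y * b \<and> (\<Sum>e\<leftarrow>es. e * e) = x * (a * a) + y * (b * b)"
    unfolding x_def y_def z_def using mem by (induction es) (use ab in \<open>auto simp: algebra_simps\<close>)
  then have "x = k \<and> y = l \<and> z = 1"
    using mat_trace_eigenvalues[OF A c] tr tr2 zs(2) n
    by (intro three_multiplicities[OF ab]) (auto simp: es_def)
  then have "mset es = replicate_mset k a + replicate_mset l b + {#0#}"
    using mem ab by (intro multiset_eqI) (auto simp: x_def y_def z_def count_eq_zero_iff)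
  then show ?thesis using c by (simp add: proots_linear_factors)
qed

section \<open>The quadratic equation for the Laplacian matrix\<close>

definition nbrs :: "'a pair_pre_digraph \<Rightarrow> 'a \<Rightarrow> 'a set" where
  "nbrs G u = {v \<in> pverts G. (u, v) \<in> parcs G}"

text \<open>The Laplacian entries indexed by vertices; this confines the arbitrary enumeration to
  the passage between matrices and graphs.\<close>

definition lap :: "'a pair_pre_digraph \<Rightarrow> 'a \<Rightarrow> 'a \<Rightarrow> real" where
  "lap G u v = (if u = v then real (card (nbrs G u)) else 0) - (if (u, v) \<in> parcs G then 1 else 0)"

lemma pair_graph_facts:
  assumes "pair_graph G"
  shows "finite (pverts G)" "(u, v) \<in> parcs G \<Longrightarrow> u \<in> pverts G \<and> v \<in> pverts G"
    "(u, u) \<notin> parcs G" "(u, v) \<in> parcs G \<longleftrightarrow> (v, u) \<in> parcs G"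
proof -
  interpret pair_graph G by fact
  show "finite (pverts G)" by simp
  show "(u, v) \<in> parcs G \<Longrightarrow> u \<in> pverts G \<and> v \<in> pverts G" using in_arcsD1 in_arcsD2 by blast
  show "(u, u) \<notin> parcs G" using no_loops' by blast
  show "(u, v) \<in> parcs G \<longleftrightarrow> (v, u) \<in> parcs G" using arcs_symmetric by blast
qed

lemma finite_nbrs [simp]: "pair_graph G \<Longrightarrow> finite (nbrs G u)"
  using pair_graph_facts(1)[of G] by (simp add: nbrs_def)

lemma out_degree_eq_card_nbrs:
  assumes "pair_graph G"
  shows "out_degree G u = card (nbrs G u)"
proof -
  have "out_arcs G u = Pair u ` nbrs G u"
    using pair_graph_facts(2)[OF assms] by (force simp: out_arcs_def nbrs_def)
  then show ?thesis by (simp add: out_degree_def card_image inj_on_def)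
qed

lemma vertex_enum:
  assumes "finite (pverts G)"
  shows "distinct (vertex_enum G)" "set (vertex_enum G) = pverts G" "length (vertex_enum G) = card (pverts G)"
proof -
  have "\<exists>vs. distinct vs \<and> set vs = pverts G" using finite_distinct_list[OF assms] by blast
  then have "distinct (vertex_enum G) \<and> set (vertex_enum G) = pverts G"
    unfolding vertex_enum_def by (rule someI_ex)
  then show "distinct (vertex_enum G)" "set (vertex_enum G) = pverts G"
    "length (vertex_enum G) = card (pverts G)"
    using distinct_card by fastforce+
qed

lemma laplacian_matrix_eq:
  assumes "pair_graph G" "card (pverts G) = n"
  shows "laplacian_matrix G = mat n n (\<lambda>(i, j). lap G (vertex_enum G ! i) (vertex_enum G ! j))"
  using vertex_enum[OF pair_graph_facts(1)[OF assms(1)]] assms(2)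
  by (auto simp: laplacian_matrix_def degree_matrix_def adjacency_matrix_def lap_def Let_def
      out_degree_eq_card_nbrs[OF assms(1)] nth_eq_iff_index_eq intro!: eq_matI)

lemma sum_vertex_enum:
  assumes "finite (pverts G)" "card (pverts G) = n"
  shows "(\<Sum>i<n. f (vertex_enum G ! i)) = (\<Sum>v\<in>pverts G. f v)"
proof -
  have "bij_betw ((!) (vertex_enum G)) {..<n} (pverts G)"
    using vertex_enum[OF assms(1)] assms(2) by (intro bij_betw_nth) auto
  then show ?thesis by (rule sum.reindex_bij_betw)
qed

lemma sum_adjacent:
  assumes "pair_graph G"
  shows "(\<Sum>w\<in>pverts G. if (u, w) \<in> parcs G \<and> P w then 1 else 0 :: real) = card {w \<in> nbrs G u. P w}"
proof -
  have "{w \<in> pverts G. (u, w) \<in> parcs G \<and> P w} = {w \<in> nbrs G u. P w}" by (auto simp: nbrs_def)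
  then show ?thesis using pair_graph_facts(1)[OF assms] by (simp flip: sum.inter_filter)
qed

lemma lap_row_sum:
  assumes G: "pair_graph G" and u: "u \<in> pverts G"
  shows "(\<Sum>v\<in>pverts G. lap G u v) = 0"
  using sum_adjacent[OF G, of u "\<lambda>_. True"] u pair_graph_facts(1)[OF G]
  by (simp add: lap_def sum_subtractf)

lemma lap_commute: "pair_graph G \<Longrightarrow> lap G u v = lap G v u"
  using pair_graph_facts(4)[of G u v] by (auto simp: lap_def)

text \<open>With \<open>L = D - A\<close> this is \<open>D^2 - DA - AD + A^2\<close>, where the
  entries of \<open>A^2\<close> count common neighbours.\<close>

lemma lap_square:
  assumes G: "pair_graph G" and uv: "u \<in> pverts G" "v \<in> pverts G"
  shows "(\<Sum>w\<in>pverts G. lap G u w * lap G w v) =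
    (if u = v then (real (card (nbrs G u)))\<^sup>2 else 0)
    - (if (u, v) \<in> parcs G then real (card (nbrs G u)) + real (card (nbrs G v)) else 0)
    + card (nbrs G u \<inter> nbrs G v)"
proof -
  have "(\<Sum>w\<in>pverts G. lap G u w * lap G w v) = (\<Sum>w\<in>pverts G.
      (if w = u then if u = v then (real (card (nbrs G u)))\<^sup>2 else 0 else 0)
      - (if w = u then if (u, v) \<in> parcs G then real (card (nbrs G u)) else 0 else 0)
      - (if w = v then if (u, v) \<in> parcs G then real (card (nbrs G v)) else 0 else 0)
      + (if (u, w) \<in> parcs G \<and> (w, v) \<in> parcs G then 1 else 0))"
    using pair_graph_facts(3)[OF G]
    by (intro sum.cong) (auto simp: lap_def power2_eq_square)
  also have "\<dots> = (if u = v then (real (card (nbrs G u)))\<^sup>2 else 0)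
    - (if (u, v) \<in> parcs G then real (card (nbrs G u)) + real (card (nbrs G v)) else 0)
    + card {w \<in> nbrs G u. (w, v) \<in> parcs G}"
    using uv pair_graph_facts(1)[OF G] by (simp add: sum.distrib sum_subtractf sum_adjacent[OF G])
  also have "{w \<in> nbrs G u. (w, v) \<in> parcs G} = nbrs G u \<inter> nbrs G v"
    using pair_graph_facts(4)[OF G] by (auto simp: nbrs_def)
  finally show ?thesis .
qed

text \<open>
  The entries of \<open>(L - a)(L - b) = (ab/n) J\<close>, where \<open>L\<close> is the Laplacian matrix and \<open>J\<close> the all-ones matrix.
\<close>

definition lap_quadratic :: "'a pair_pre_digraph \<Rightarrow> real \<Rightarrow> real \<Rightarrow> bool" where
  "lap_quadratic G a b \<longleftrightarrow>
     (let V = pverts G; d = (\<lambda>u. real (card (nbrs G u)));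
          c = (\<lambda>u v. real (card (nbrs G u \<inter> nbrs G v))); \<mu> = a * b / card V in
      (\<forall>u\<in>V. (d u)\<^sup>2 + d u - (a + b) * d u + a * b = \<mu>) \<and>
      (\<forall>u\<in>V. \<forall>v\<in>V. (u, v) \<in> parcs G \<longrightarrow> c u v - d u - d v + a + b = \<mu>) \<and>
      (\<forall>u\<in>V. \<forall>v\<in>V. u \<noteq> v \<longrightarrow> (u, v) \<notin> parcs G \<longrightarrow> c u v = \<mu>))"

lemma lap_quadratic_iff:
  assumes G: "pair_graph G" and n: "card (pverts G) = n"
  shows "lap_quadratic G a b \<longleftrightarrow> (\<forall>u\<in>pverts G. \<forall>v\<in>pverts G.
    (\<Sum>w\<in>pverts G. lap G u w * lap G w v) - (a + b) * lap G u v + (if u = v then a * b else 0) = a * b / n)"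
    (is "_ \<longleftrightarrow> (\<forall>u\<in>_. \<forall>v\<in>_. ?E u v)")
proof -
  have diag: "?E u u \<longleftrightarrow> (real (card (nbrs G u)))\<^sup>2 + card (nbrs G u) - (a + b) * card (nbrs G u) + a * b = a * b / n"
    if "u \<in> pverts G" for u
    using that pair_graph_facts(3)[OF G] by (simp add: lap_square[OF G]) (simp add: lap_def)
  have adj: "?E u v \<longleftrightarrow> real (card (nbrs G u \<inter> nbrs G v)) - card (nbrs G u) - card (nbrs G v) + a + b = a * b / n"
    if "u \<in> pverts G" "v \<in> pverts G" "(u, v) \<in> parcs G" for u v
  proof -
    have "u \<noteq> v" using that pair_graph_facts(3)[OF G] by auto
    then show ?thesis using that by (simp add: lap_square[OF G]) (simp add: lap_def algebra_simps)
  qed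
  have nonadj: "?E u v \<longleftrightarrow> real (card (nbrs G u \<inter> nbrs G v)) = a * b / n"
    if "u \<in> pverts G" "v \<in> pverts G" "u \<noteq> v" "(u, v) \<notin> parcs G" for u v
    using that by (simp add: lap_square[OF G]) (simp add: lap_def)
  have "(\<forall>u\<in>pverts G. \<forall>v\<in>pverts G. ?E u v) \<longleftrightarrow> (\<forall>u\<in>pverts G. ?E u u) \<and>
      (\<forall>u\<in>pverts G. \<forall>v\<in>pverts G. (u, v) \<in> parcs G \<longrightarrow> ?E u v) \<and>
      (\<forall>u\<in>pverts G. \<forall>v\<in>pverts G. u \<noteq> v \<longrightarrow> (u, v) \<notin> parcs G \<longrightarrow> ?E u v)" (is "_ \<longleftrightarrow> ?rhs")
  proof (intro iffI conjI ballI impI)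
    fix u v assume *: ?rhs "u \<in> pverts G" "v \<in> pverts G"
    show "?E u v"
    proof (cases "u = v")
      case True
      have "?E u u" using conjunct1[OF *(1)] *(2) by (rule bspec)
      then show ?thesis using True by (simp only:)
    next
      case False
      then show ?thesis using conjunct2[OF *(1)] *(2,3) by fastforce
    qed
  qed (drule (1) bspec, drule (1) bspec, simp)+
  also have "?rhs \<longleftrightarrow> lap_quadratic G a b"
    unfolding lap_quadratic_def Let_def n
    by (intro conj_cong ball_cong imp_cong refl diag adj nonadj) auto
  finally show ?thesis by blast
qed

text \<open>The bridge from spectra to counting, crossed in both directions later. The quadratic
  equation confines the eigenvalues to 0, \<open>a\<close> and \<open>b\<close>; the degree sum,
  which is the trace, fixes how often each occurs.\<close>

theorem laplacian_spectrum_iff: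
  assumes G: "pair_graph G" and n: "card (pverts G) = n" "n = k + l + 1" "k > 0" "l > 0"
    and ab: "a \<noteq> 0" "b \<noteq> 0" "a \<noteq> b"
  shows "laplacian_spectrum G = replicate_mset k a + replicate_mset l b + {#0#} \<longleftrightarrow>
    lap_quadratic G a b \<and> (\<Sum>u\<in>pverts G. real (card (nbrs G u))) = k * a + l * b"
proof -
  let ?A = "laplacian_matrix G" and ?f = "\<lambda>i. vertex_enum G ! i"
  note fin = pair_graph_facts(1)[OF G]
  note E = laplacian_matrix_eq[OF G n(1)] and S = sum_vertex_enum[OF fin n(1)]
  note ve = vertex_enum[OF fin, unfolded n(1)]
  have A: "?A \<in> carrier_mat n n" unfolding E by simp
  have idx: "?A $$ (i, j) = lap G (?f i) (?f j)" if "i < n" "j < n" for i j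
    using that by (simp add: E)
  have sym: "transpose_mat ?A = ?A"
    unfolding E using lap_commute[OF G] by (intro eq_matI) auto
  have mem: "?f i \<in> pverts G" if "i < n" for i using ve that nth_mem by metis
  have row: "(\<Sum>j<n. ?A $$ (i, j)) = 0" if "i < n" for i
    using that S[of "lap G (?f i)"] lap_row_sum[OF G mem[OF that]] by (simp add: idx)
  have tr: "mat_trace ?A = (\<Sum>u\<in>pverts G. real (card (nbrs G u)))"
    using A S[of "\<lambda>u. lap G u u"] pair_graph_facts(3)[OF G] by (simp add: mat_trace_def idx) (simp add: lap_def)
  have q: "quad_mat ?A a b $$ (i, j) = (\<Sum>w\<in>pverts G. lap G (?f i) w * lap G w (?f j))
      - (a + b) * lap G (?f i) (?f j) + (if ?f i = ?f j then a * b else 0)" if ij: "i < n" "j < n" for i j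
  proof -
    have "(?A * ?A) $$ (i, j) = (\<Sum>w\<in>pverts G. lap G (?f i) w * lap G w (?f j))"
      using A ij S[of "\<lambda>w. lap G (?f i) w * lap G w (?f j)"]
      by (subst index_mult_mat_sum[of _ n n _ n]) (auto simp: idx)
    then show ?thesis
      using A ij ve by (simp add: quad_mat_def idx nth_eq_iff_index_eq algebra_simps del: index_mult_mat(1))
  qed
  have quad: "lap_quadratic G a b \<longleftrightarrow> (\<forall>i<n. \<forall>j<n. quad_mat ?A a b $$ (i, j) = a * b / n)"
  proof -
    have ball: "(\<forall>u\<in>pverts G. P u) \<longleftrightarrow> (\<forall>i<n. P (?f i))" for P
      using all_set_conv_all_nth[of "vertex_enum G" P] ve by simp
    show ?thesis unfolding lap_quadratic_iff[OF G n(1)] ball by (simp add: q)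
  qed
  show ?thesis
    unfolding laplacian_spectrum_def quad tr[symmetric]
  proof (intro iffI conjI allI impI)
    fix i j assume *: "proots (char_poly ?A) = replicate_mset k a + replicate_mset l b + {#0#}" "i < n" "j < n"
    show "quad_mat ?A a b $$ (i, j) = a * b / n" by (rule quad_mat_const(1)[OF A sym row *(1) n(3,4,2) *(2,3)])
  next
    assume "proots (char_poly ?A) = replicate_mset k a + replicate_mset l b + {#0#}"
    \<comment> \<open>An index pair has to be supplied; 0 is a legal index because
      \<open>n = k + l + 1\<close>.\<close>
    from quad_mat_const(2)[OF A sym row this n(3,4,2), of 0 0] n(2)
    show "mat_trace ?A = k * a + l * b" by simp
  next
    assume *: "(\<forall>i<n. \<forall>j<n. quad_mat ?A a b $$ (i, j) = a * b / n) \<and> mat_trace ?A = k * a + l * b"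
    show "proots (char_poly ?A) = replicate_mset k a + replicate_mset l b + {#0#}"
      using * by (intro spectrum_of_quad_mat[OF A row _ _ ab n(2)]) blast+
  qed
qed

section \<open>Idempotents of rank two\<close>

text \<open>Idempotence says that \<open>P\<close> fixes its own columns, and by symmetry the
  squared norm of column \<open>w\<close> is \<open>P w w\<close>. A nonzero trace supplies a column
  that can be normalised.\<close>

lemma symmetric_idempotent_unit_vector:
  fixes P :: "'a \<Rightarrow> 'a \<Rightarrow> real"
  assumes V: "finite V" and sym: "\<And>u v. u \<in> V \<Longrightarrow> v \<in> V \<Longrightarrow> P u v = P v u"
    and idem: "\<And>u v. u \<in> V \<Longrightarrow> v \<in> V \<Longrightarrow> (\<Sum>w\<in>V. P u w * P w v) = P u v"
    and tr: "(\<Sum>u\<in>V. P u u) \<noteq> 0"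
  obtains x where "(\<Sum>u\<in>V. (x u)\<^sup>2) = 1" "\<And>u. u \<in> V \<Longrightarrow> (\<Sum>w\<in>V. P u w * x w) = x u"
proof -
  obtain w where w: "w \<in> V" "P w w \<noteq> 0" using tr by (meson sum.neutral)
  have sq: "(\<Sum>u\<in>V. (P u w)\<^sup>2) = P w w"
    unfolding idem[OF w(1) w(1), symmetric] power2_eq_square using w(1) sym by (intro sum.cong) auto
  then have pos: "P w w > 0" using w(2) sum_nonneg[of V "\<lambda>u. (P u w)\<^sup>2"] by simp
  define x where "x u = P u w / sqrt (P w w)" for u
  show thesis
  proof (rule that[of x])
    show "(\<Sum>u\<in>V. (x u)\<^sup>2) = 1"
      using pos sq by (simp add: x_def power_divide flip: sum_divide_distrib)
    show "(\<Sum>w\<in>V. P u w * x w) = x u" if "u \<in> V" for u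
      using idem[OF that w(1)] by (simp add: x_def flip: sum_divide_distrib)
  qed
qed

text \<open>Splits off one dimension of the range: \<open>P x = x\<close> and symmetry give
  \<open>P x x^T = x x^T P = x x^T\<close>, so \<open>P - x x^T\<close> is again idempotent, kills
  \<open>x\<close>, and has trace smaller by 1.\<close>

lemma symmetric_idempotent_deflate:
  fixes P :: "'a \<Rightarrow> 'a \<Rightarrow> real"
  assumes sym: "\<And>u v. u \<in> V \<Longrightarrow> v \<in> V \<Longrightarrow> P u v = P v u"
    and idem: "\<And>u v. u \<in> V \<Longrightarrow> v \<in> V \<Longrightarrow> (\<Sum>w\<in>V. P u w * P w v) = P u v"
    and x: "(\<Sum>u\<in>V. (x u)\<^sup>2) = 1" "\<And>u. u \<in> V \<Longrightarrow> (\<Sum>w\<in>V. P u w * x w) = x u"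
    and uv: "u \<in> V" "v \<in> V"
  shows "(\<Sum>w\<in>V. (P u w - x u * x w) * (P w v - x w * x v)) = P u v - x u * x v"
    "(\<Sum>w\<in>V. (P u w - x u * x w) * x w) = 0"
proof -
  have x': "(\<Sum>w\<in>V. x w * P w v) = x v"
    unfolding x(2)[OF uv(2), symmetric] using sym uv by (intro sum.cong) auto
  have "(\<Sum>w\<in>V. (P u w - x u * x w) * (P w v - x w * x v)) = (\<Sum>w\<in>V. P u w * P w v)
      - (\<Sum>w\<in>V. P u w * x w) * x v - x u * (\<Sum>w\<in>V. x w * P w v) + x u * x v * (\<Sum>w\<in>V. (x w)\<^sup>2)"
    by (simp add: algebra_simps power2_eq_square sum.distrib sum_subtractf sum_distrib_left sum_distrib_right)
  then show "(\<Sum>w\<in>V. (P u w - x u * x w) * (P w v - x w * x v)) = P u v - x u * x v"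
    using uv by (simp add: idem x x')
  have "(\<Sum>w\<in>V. (P u w - x u * x w) * x w) = (\<Sum>w\<in>V. P u w * x w) - x u * (\<Sum>w\<in>V. (x w)\<^sup>2)"
    by (simp add: algebra_simps power2_eq_square sum_subtractf sum_distrib_left)
  then show "(\<Sum>w\<in>V. (P u w - x u * x w) * x w) = 0" using uv by (simp add: x)
qed

text \<open>The diagonal entries are squared row norms, hence nonnegative, and trace 0 makes every
  row vanish.\<close>

lemma symmetric_idempotent_trace_0:
  fixes P :: "'a \<Rightarrow> 'a \<Rightarrow> real"
  assumes V: "finite V" and sym: "\<And>u v. u \<in> V \<Longrightarrow> v \<in> V \<Longrightarrow> P u v = P v u"
    and idem: "\<And>u v. u \<in> V \<Longrightarrow> v \<in> V \<Longrightarrow> (\<Sum>w\<in>V. P u w * P w v) = P u v"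
    and tr: "(\<Sum>u\<in>V. P u u) = 0" and uv: "u \<in> V" "v \<in> V"
  shows "P u v = 0"
proof -
  have sq: "(\<Sum>w\<in>V. (P u w)\<^sup>2) = P u u" if "u \<in> V" for u
    unfolding idem[OF that that, symmetric] power2_eq_square using that sym by (intro sum.cong) auto
  have "P u u \<ge> 0" if "u \<in> V" for u using sq[OF that] sum_nonneg[of V "\<lambda>w. (P u w)\<^sup>2"] by simp
  then have "P u u = 0" using tr V uv by (simp add: sum_nonneg_eq_0_iff)
  then show ?thesis using sq[OF uv(1)] V uv by (simp add: sum_nonneg_eq_0_iff)
qed

text \<open>Deflating twice leaves trace 0, hence nothing. The second vector lies in the range of
  the deflated matrix \<open>Q\<close>, which kills the first, so the two unit vectors are
  orthogonal. By Lagrange's identity their squared 2x2 minors then sum to 2, and some minor is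
  nonzero: the points of \<open>i\<close> and \<open>j\<close> form a basis of the plane.\<close>

lemma symmetric_idempotent_trace_2:
  fixes P :: "'a \<Rightarrow> 'a \<Rightarrow> real"
  assumes V: "finite V" and sym: "\<And>u v. u \<in> V \<Longrightarrow> v \<in> V \<Longrightarrow> P u v = P v u"
    and idem: "\<And>u v. u \<in> V \<Longrightarrow> v \<in> V \<Longrightarrow> (\<Sum>w\<in>V. P u w * P w v) = P u v"
    and tr: "(\<Sum>u\<in>V. P u u) = 2"
  obtains x y i j where "\<And>u v. u \<in> V \<Longrightarrow> v \<in> V \<Longrightarrow> P u v = x u * x v + y u * y v"
    "i \<in> V" "j \<in> V" "x i * y j - x j * y i \<noteq> 0"
proof -
  obtain x where x: "(\<Sum>u\<in>V. (x u)\<^sup>2) = 1" "\<And>u. u \<in> V \<Longrightarrow> (\<Sum>w\<in>V. P u w * x w) = x u"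
    using symmetric_idempotent_unit_vector[OF V sym idem] tr by auto
  define Q where "Q u v = P u v - x u * x v" for u v
  have Qsym: "Q u v = Q v u" if "u \<in> V" "v \<in> V" for u v using sym[OF that] by (simp add: Q_def)
  have Qidem: "(\<Sum>w\<in>V. Q u w * Q w v) = Q u v" if "u \<in> V" "v \<in> V" for u v
    unfolding Q_def by (rule symmetric_idempotent_deflate(1)[OF sym idem x that])
  have Qx: "(\<Sum>w\<in>V. Q u w * x w) = 0" if "u \<in> V" for u
    unfolding Q_def by (rule symmetric_idempotent_deflate(2)[OF sym idem x that that])
  have Qtr: "(\<Sum>u\<in>V. Q u u) = 1" using tr x(1) by (simp add: Q_def sum_subtractf power2_eq_square)
  obtain y where y: "(\<Sum>u\<in>V. (y u)\<^sup>2) = 1" "\<And>u. u \<in> V \<Longrightarrow> (\<Sum>w\<in>V. Q u w * y w) = y u"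
    using symmetric_idempotent_unit_vector[OF V Qsym Qidem] Qtr by auto
  define R where "R u v = Q u v - y u * y v" for u v
  have Rsym: "R u v = R v u" if "u \<in> V" "v \<in> V" for u v using Qsym[OF that] by (simp add: R_def)
  have Ridem: "(\<Sum>w\<in>V. R u w * R w v) = R u v" if "u \<in> V" "v \<in> V" for u v
    unfolding R_def by (rule symmetric_idempotent_deflate(1)[OF Qsym Qidem y that])
  have Rtr: "(\<Sum>u\<in>V. R u u) = 0" using Qtr y(1) by (simp add: R_def sum_subtractf power2_eq_square)
  have xy: "(\<Sum>u\<in>V. x u * y u) = 0"
  proof -
    have "(\<Sum>u\<in>V. x u * y u) = (\<Sum>u\<in>V. \<Sum>w\<in>V. x u * (Q u w * y w))"
      using y(2) by (simp flip: sum_distrib_left)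
    also have "\<dots> = (\<Sum>w\<in>V. \<Sum>u\<in>V. y w * (Q w u * x u))"
      by (subst sum.swap) (use Qsym in \<open>auto intro!: sum.cong\<close>)
    also have "\<dots> = 0" by (simp add: Qx flip: sum_distrib_left)
    finally show ?thesis .
  qed
  have "(\<Sum>i\<in>V. \<Sum>j\<in>V. (x i * y j - x j * y i)\<^sup>2) =
      2 * (\<Sum>i\<in>V. (x i)\<^sup>2) * (\<Sum>j\<in>V. (y j)\<^sup>2) - 2 * (\<Sum>i\<in>V. x i * y i) * (\<Sum>j\<in>V. x j * y j)"
  proof -
    have "(\<Sum>i\<in>V. \<Sum>j\<in>V. (x i * y j - x j * y i)\<^sup>2) = (\<Sum>i\<in>V. \<Sum>j\<in>V. (x i)\<^sup>2 * (y j)\<^sup>2)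
        + (\<Sum>i\<in>V. \<Sum>j\<in>V. (x j)\<^sup>2 * (y i)\<^sup>2) - 2 * (\<Sum>i\<in>V. \<Sum>j\<in>V. (x i * y i) * (x j * y j))"
      by (simp add: power2_eq_square algebra_simps sum.distrib sum_subtractf sum_distrib_left)
    also have "(\<Sum>i\<in>V. \<Sum>j\<in>V. (x j)\<^sup>2 * (y i)\<^sup>2) = (\<Sum>i\<in>V. \<Sum>j\<in>V. (x i)\<^sup>2 * (y j)\<^sup>2)"
      by (rule sum.swap)
    finally show ?thesis by (simp flip: sum_product)
  qed
  also have "\<dots> \<noteq> 0" by (simp add: x y xy)
  finally obtain i where i: "i \<in> V" "(\<Sum>j\<in>V. (x i * y j - x j * y i)\<^sup>2) \<noteq> 0" by (meson sum.neutral)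
  then obtain j where "j \<in> V" "(x i * y j - x j * y i)\<^sup>2 \<noteq> 0" by (meson sum.neutral)
  moreover have "P u v = x u * x v + y u * y v" if "u \<in> V" "v \<in> V" for u v
    using symmetric_idempotent_trace_0[OF V Rsym Ridem Rtr that] by (simp add: R_def Q_def)
  ultimately show thesis using that i(1) by auto
qed

section \<open>The order of the graph is an eigenvalue\<close>

lemma card_nbrs_less:
  assumes G: "pair_graph G" and u: "u \<in> pverts G"
  shows "card (nbrs G u) < card (pverts G)"
  using pair_graph_facts(1,3)[OF G] u by (intro psubset_card_mono) (auto simp: nbrs_def)

lemma lap_quadraticD:
  assumes "lap_quadratic G a b" "card (pverts G) = n" "u \<in> pverts G"
  shows "(real (card (nbrs G u)))\<^sup>2 + card (nbrs G u) - (a + b) * card (nbrs G u) + a * b = a * b / n"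
    "(u, v) \<in> parcs G \<Longrightarrow> v \<in> pverts G \<Longrightarrow>
      real (card (nbrs G u \<inter> nbrs G v)) - card (nbrs G u) - card (nbrs G v) + a + b = a * b / n"
    "u \<noteq> v \<Longrightarrow> (u, v) \<notin> parcs G \<Longrightarrow> v \<in> pverts G \<Longrightarrow> real (card (nbrs G u \<inter> nbrs G v)) = a * b / n"
  using assms by (auto simp: lap_quadratic_def Let_def)

text \<open>
  The projection onto the \<open>b\<close>-eigenspace is \<open>(L - a + (a/n) J) / (b - a)\<close>. It has rank 2, so it is the Gram
  matrix of points in the plane. Two of these points are a basis, and by the two-valued inner products with
  them the remaining points lie on the four vertices of a parallelogram; coincident points force \<open>a = n\<close> or
  \<open>b = n\<close>.
\<close>

lemma eigenvalue_eq_order_or_order_le_6: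
  assumes G: "pair_graph G" and n: "card (pverts G) = n" "n \<ge> 3"
    and q: "lap_quadratic G a b" and ab: "a > 0" "b > 0" "a \<noteq> b"
    and tr: "(\<Sum>u\<in>pverts G. real (card (nbrs G u))) = (real n - 3) * a + 2 * b"
  shows "a = n \<or> b = n \<or> n \<le> 6"
proof (rule ccontr)
  assume "\<not> ?thesis"
  then have an: "a \<noteq> n" "b \<noteq> n" and n6: "n > 6" by auto
  define V where "V = pverts G"
  have V: "finite V" "card V = n" using pair_graph_facts(1)[OF G] n by (auto simp: V_def)
  have n0: "real n > 0" using n by simp
  define c where "c = a / n"
  have nc: "real n * c = a" using n0 by (simp add: c_def)
  \<comment> \<open>On the all-ones vector the shift \<open>-a\<close> cancels against
    \<open>n * c = a\<close>; on the \<open>a\<close>-eigenspace \<open>L - a\<close> vanishes. Only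
    the \<open>b\<close>-eigenspace survives, with factor \<open>b - a\<close>.\<close>
  define M where "M u v = lap G u v - (if u = v then a else 0) + c" for u v
  have lap2: "(\<Sum>w\<in>V. lap G u w * lap G w v) = (a + b) * lap G u v - (if u = v then a * b else 0) + c * b"
    if "u \<in> V" "v \<in> V" for u v
  proof -
    have "(\<Sum>w\<in>V. lap G u w * lap G w v) - (a + b) * lap G u v + (if u = v then a * b else 0) = a * b / n"
      using q that unfolding lap_quadratic_iff[OF G n(1)] V_def by blast
    then show ?thesis by (auto simp: c_def)
  qed
  have Msq: "(\<Sum>w\<in>V. M u w * M w v) = (b - a) * M u v" if uv: "u \<in> V" "v \<in> V" for u v
  proof -
    have "(\<Sum>w\<in>V. M u w * M w v) = (\<Sum>w\<in>V. lap G u w * lap G w v - (if w = u then a * lap G u v else 0)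
        - (if w = v then a * lap G u v else 0) + (if w = u then if u = v then a * a else 0 else 0)
        + c * lap G u w + c * lap G v w - (if w = u then a * c else 0) - (if w = v then a * c else 0) + c * c)"
      using lap_commute[OF G] by (intro sum.cong) (auto simp: M_def algebra_simps)
    also have "\<dots> = (\<Sum>w\<in>V. lap G u w * lap G w v) - 2 * a * lap G u v + (if u = v then a * a else 0)
        - 2 * a * c + n * c * c"
      using V uv lap_row_sum[OF G, of u] lap_row_sum[OF G, of v]
      by (simp add: sum.distrib sum_subtractf flip: V_def sum_distrib_left)
    also have "\<dots> = (b - a) * M u v"
      unfolding nc lap2[OF uv] by (auto simp: M_def algebra_simps)
    finally show ?thesis .
  qed
  have Mtr: "(\<Sum>u\<in>V. M u u) = 2 * (b - a)"
  proof -
    have "(\<Sum>u\<in>V. M u u) = (\<Sum>u\<in>V. real (card (nbrs G u))) - n * a + n * c"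
      using V pair_graph_facts(3)[OF G] by (simp add: M_def lap_def sum.distrib sum_subtractf)
    then show ?thesis using tr nc by (simp add: V_def algebra_simps)
  qed
  define P where "P u v = M u v / (b - a)" for u v
  have ba: "b - a \<noteq> 0" using ab by simp
  have sym: "P u v = P v u" if "u \<in> V" "v \<in> V" for u v
    using lap_commute[OF G, of u v] by (simp add: P_def M_def)
  have idem: "(\<Sum>w\<in>V. P u w * P w v) = P u v" if "u \<in> V" "v \<in> V" for u v
    using Msq[OF that] ba by (simp add: P_def flip: sum_divide_distrib)
  have trP: "(\<Sum>u\<in>V. P u u) = 2"
    unfolding P_def sum_divide_distrib[symmetric] Mtr using ba by (rule nonzero_mult_div_cancel_right)
  obtain x y i j where xy: "\<And>u v. u \<in> V \<Longrightarrow> v \<in> V \<Longrightarrow> P u v = x u * x v + y u * y v"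
    and ij: "i \<in> V" "j \<in> V" "x i * y j - x j * y i \<noteq> 0"
    using symmetric_idempotent_trace_2[OF V(1) sym idem trP] by metis
  have "inj_on (\<lambda>w. ((w, i) \<in> parcs G, (w, j) \<in> parcs G)) (V - {i, j})"
  proof (rule inj_onI, rule ccontr)
    fix w w' assume w: "w \<in> V - {i, j}" "w' \<in> V - {i, j}" "w \<noteq> w'"
      and eq: "((w, i) \<in> parcs G, (w, j) \<in> parcs G) = ((w', i) \<in> parcs G, (w', j) \<in> parcs G)"
    have "P w i = P w' i" "P w j = P w' j" using w eq by (auto simp: P_def M_def lap_def)
    then have 1: "(x w - x w') * x i + (y w - y w') * y i = 0" "(x w - x w') * x j + (y w - y w') * y j = 0"
      using w ij by (auto simp: xy algebra_simps)
    \<comment> \<open>Cramer's rule for the system \<open>1\<close>, whose determinant is the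
      nonzero minor of \<open>i\<close> and \<open>j\<close>.\<close>
    have "(x w - x w') * (x i * y j - x j * y i) = ((x w - x w') * x i + (y w - y w') * y i) * y j
        - ((x w - x w') * x j + (y w - y w') * y j) * y i"
      "(y w - y w') * (x i * y j - x j * y i) = ((x w - x w') * x j + (y w - y w') * y j) * x i
        - ((x w - x w') * x i + (y w - y w') * y i) * x j"
      by (simp_all add: algebra_simps)
    then have "x w = x w'" "y w = y w'" using ij(3) unfolding 1 by auto
    then have "P w w = P w' w" using w by (simp add: xy)
    \<comment> \<open>Coincident points equate a diagonal with an off-diagonal entry, which leaves
      only the degrees \<open>a\<close> and \<open>a - 1\<close>. The diagonal equation has
      left-hand side \<open>a\<close> for the former and \<open>b\<close> for the latter, so
      \<open>a\<close> or \<open>b\<close> equals \<open>a b / n\<close>.\<close>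
    then have "real (card (nbrs G w)) = a - (if (w', w) \<in> parcs G then 1 else 0)"
      using ba w(3) pair_graph_facts(3)[OF G] by (auto simp: P_def M_def lap_def)
    then consider "real (card (nbrs G w)) = a" | "real (card (nbrs G w)) = a - 1" by (auto split: if_splits)
    then show False
    proof cases
      case 1
      then have "a = a * b / n"
        using lap_quadraticD(1)[OF q n(1), of w] w by (simp add: V_def power2_eq_square algebra_simps)
      then have "a * (n - b) = 0" using n0 by (simp add: field_simps)
      then show False using an ab by simp
    next
      case 2
      then have "b = a * b / n"
        using lap_quadraticD(1)[OF q n(1), of w] w by (simp only: V_def power2_eq_square) (simp add: algebra_simps)
      then have "b * (n - a) = 0" using n0 by (simp add: field_simps)
      then show False using an ab by simp
    qed
  qed
  then have "card (V - {i, j}) \<le> card (UNIV :: (bool \<times> bool) set)"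
    by (rule card_inj_on_le) auto
  also have "card (UNIV :: (bool \<times> bool) set) = 4" by (simp add: card_UNIV_bool flip: UNIV_Times_UNIV)
  finally have "card V - card {i, j} \<le> 4" using V ij by (subst (asm) card_Diff_subset) auto
  moreover have "card {i, j} \<le> 2" by (simp add: card_insert_if)
  ultimately show False using V n6 by simp
qed

lemma square_between_consecutive_squares:
  fixes x k :: int
  assumes "k\<^sup>2 < x\<^sup>2" "x\<^sup>2 < (k + 1)\<^sup>2" "k \<ge> 0"
  shows False
  using power2_less_imp_less[of k "\<bar>x\<bar>"] power2_less_imp_less[of "\<bar>x\<bar>" "k + 1"] assms by simp

text \<open>Here \<open>m = a b / 6\<close> counts the common neighbours of a nonadjacent pair and
  \<open>d\<close> is a degree, so \<open>a + b = d + 1 + 5 m / d\<close>. Running through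
  \<open>d\<close> and \<open>m\<close> leaves \<open>a + b = 6 + m\<close>, where
  \<open>(a - 6)(b - 6) = 0\<close>, and four other pairs. For these \<open>(a - b)^2\<close> would
  be 96, 217, 388 or 73, none of which is a square.\<close>

lemma no_six_vertex_parameters:
  fixes a b d m :: nat
  assumes ab: "a * b = 6 * m" and m: "m > 0" "m \<le> 4" and d: "d \<le> 5"
    and eq: "d * d + d + 5 * m = (a + b) * d"
  shows "a = 6 \<or> b = 6"
proof -
  have "d > 0" using m eq by (cases d) auto
  then have "d = 1 \<or> d = 2 \<or> d = 3 \<or> d = 4 \<or> d = 5" using d by arith
  moreover have "m = 1 \<or> m = 2 \<or> m = 3 \<or> m = 4" using m by arith
  ultimately have "a + b = 6 + m \<or> a + b = 12 \<and> m = 2 \<or> a + b = 17 \<and> m = 3 \<or>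
      a + b = 22 \<and> m = 4 \<or> a + b = 13 \<and> m = 4"
    using eq by (elim disjE) (simp_all, presburger+)
  then show ?thesis
  proof (elim disjE conjE)
    assume "a + b = 6 + m"
    then have "(int a - 6) * (int b - 6) = 0"
      using arg_cong[OF ab, of int] by (simp add: algebra_simps)
    then show ?thesis by auto
  next
    assume *: "a + b = 12" "m = 2"
    have "(int a - int b)\<^sup>2 = (int (a + b))\<^sup>2 - 4 * int (a * b)" by (simp add: power2_eq_square algebra_simps)
    also have "\<dots> = 96" unfolding ab * by simp
    finally show ?thesis using square_between_consecutive_squares[of 9 "int a - int b"] by simp
  next
    assume *: "a + b = 17" "m = 3"
    have "(int a - int b)\<^sup>2 = (int (a + b))\<^sup>2 - 4 * int (a * b)" by (simp add: power2_eq_square algebra_simps)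
    also have "\<dots> = 217" unfolding ab * by simp
    finally show ?thesis using square_between_consecutive_squares[of 14 "int a - int b"] by simp
  next
    assume *: "a + b = 22" "m = 4"
    have "(int a - int b)\<^sup>2 = (int (a + b))\<^sup>2 - 4 * int (a * b)" by (simp add: power2_eq_square algebra_simps)
    also have "\<dots> = 388" unfolding ab * by simp
    finally show ?thesis using square_between_consecutive_squares[of 19 "int a - int b"] by simp
  next
    assume *: "a + b = 13" "m = 4"
    have "(int a - int b)\<^sup>2 = (int (a + b))\<^sup>2 - 4 * int (a * b)" by (simp add: power2_eq_square algebra_simps)
    also have "\<dots> = 73" unfolding ab * by simp
    finally show ?thesis using square_between_consecutive_squares[of 8 "int a - int b"] by simp
  qed
qed

text \<open>
  For \<open>n = 6\<close>, the sum \<open>a + b\<close> and the quotient \<open>ab/6\<close> are integers by the off-diagonal entries of the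
  quadratic equation, so \<open>a\<close> is one by the trace.
\<close>

lemma eigenvalue_eq_order:
  assumes G: "pair_graph G" and n: "card (pverts G) = n" "n \<ge> 6"
    and q: "lap_quadratic G a b" and ab: "a > 0" "b > 0" "a \<noteq> b"
    and tr: "(\<Sum>u\<in>pverts G. real (card (nbrs G u))) = (real n - 3) * a + 2 * b"
  shows "a = n \<or> b = n"
proof (rule ccontr)
  assume "\<not> ?thesis"
  then have an: "a \<noteq> n" "b \<noteq> n" by auto
  then have n6: "n = 6" using eigenvalue_eq_order_or_order_le_6[OF G n(1) _ q ab tr] n by simp
  let ?d = "\<lambda>u. card (nbrs G u)"
  have fin: "finite (pverts G)" using pair_graph_facts(1)[OF G] .
  have "\<exists>u v. u \<in> pverts G \<and> v \<in> pverts G \<and> (u, v) \<in> parcs G"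
  proof (rule ccontr)
    assume "\<not> ?thesis"
    then have "nbrs G u = {}" if "u \<in> pverts G" for u using that by (auto simp: nbrs_def)
    then have "3 * a + 2 * b = 0" using tr n6 by simp
    then show False using ab by simp
  qed
  then obtain u v where uv: "u \<in> pverts G" "v \<in> pverts G" "(u, v) \<in> parcs G" by blast
  have "\<exists>x y. x \<in> pverts G \<and> y \<in> pverts G \<and> x \<noteq> y \<and> (x, y) \<notin> parcs G"
  proof (rule ccontr)
    assume "\<not> ?thesis"
    then have "nbrs G u = pverts G - {u}"
      using uv pair_graph_facts(3)[OF G] by (auto simp: nbrs_def)
    then have "?d u = 5" using n n6 uv fin by simp
    then have "(6 - a) * (6 - b) = 0"
      using lap_quadraticD(1)[OF q n(1) uv(1)] n6 by (simp add: algebra_simps)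
    then show False using an n6 by simp
  qed
  then obtain x y where xy: "x \<in> pverts G" "y \<in> pverts G" "x \<noteq> y" "(x, y) \<notin> parcs G" by blast
  define m where "m = card (nbrs G x \<inter> nbrs G y)"
  have ab_m: "a * b = 6 * real m"
    using lap_quadraticD(3)[OF q n(1) xy(1,3,4,2)] n6 by (simp add: m_def)
  have "nbrs G x \<inter> nbrs G y \<subseteq> pverts G - {x, y}"
    using pair_graph_facts(3)[OF G] by (auto simp: nbrs_def)
  then have "m \<le> card (pverts G - {x, y})" unfolding m_def using fin by (intro card_mono) auto
  also have "\<dots> = 4" using n n6 xy by (subst card_Diff_subset) auto
  finally have m4: "m \<le> 4" .
  have m0: "m > 0" using ab_m ab by (cases m) auto
  \<comment> \<open>The equation of the edge \<open>u v\<close>, solved for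
    \<open>a + b\<close>.\<close>
  define s where "s = int m - int (card (nbrs G u \<inter> nbrs G v)) + ?d u + ?d v"
  have s: "a + b = of_int s"
    using lap_quadraticD(2)[OF q n(1) uv(1,3,2)] ab_m n6 by (simp add: s_def)
  \<comment> \<open>For six vertices the trace is \<open>3 a + 2 b\<close>, so subtracting
    \<open>2 (a + b)\<close> leaves \<open>a\<close>. Positivity makes the passage to
    \<open>nat\<close> harmless.\<close>
  define A where "A = nat ((\<Sum>u\<in>pverts G. int (?d u)) - 2 * s)"
  have "a = of_int ((\<Sum>u\<in>pverts G. int (?d u)) - 2 * s)" using tr s n6 by simp
  then have A: "a = real A" using ab unfolding A_def by (metis of_int_0_less_iff of_nat_nat order_less_imp_le of_int_of_nat_eq)
  define B where "B = nat (s - int A)"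
  have "b = of_int (s - int A)" using s A by simp
  then have B: "b = real B" using ab unfolding B_def by (metis of_int_0_less_iff of_nat_nat order_less_imp_le of_int_of_nat_eq)
  have AB: "A * B = 6 * m" using ab_m unfolding A B by (metis of_nat_eq_iff of_nat_mult of_nat_numeral)
  have "real (?d u * ?d u + ?d u + 5 * m) = real ((A + B) * ?d u)"
    using lap_quadraticD(1)[OF q n(1) uv(1)] ab_m n6 unfolding A B by (simp add: power2_eq_square)
  then have "?d u * ?d u + ?d u + 5 * m = (A + B) * ?d u" by (simp only: of_nat_eq_iff)
  moreover have "?d u \<le> 5" using card_nbrs_less[OF G uv(1)] n n6 by simp
  ultimately have "A = 6 \<or> B = 6" using no_six_vertex_parameters[OF AB m0 m4] by blast
  then show False using an n6 A B by auto
qed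

section \<open>Complete multipartite graphs\<close>

definition part :: "'a pair_pre_digraph \<Rightarrow> 'a \<Rightarrow> 'a set" where
  "part G u = {v \<in> pverts G. (u, v) \<notin> parcs G}"

text \<open>
  A graph is complete multipartite iff nonadjacency is transitive; \<open>part G u\<close> is then the part of \<open>u\<close>.
\<close>

definition uniform_multipartite :: "'a pair_pre_digraph \<Rightarrow> nat \<Rightarrow> nat \<Rightarrow> nat \<Rightarrow> bool" where
  "uniform_multipartite G n m p \<longleftrightarrow> pair_graph G \<and> card (pverts G) = n \<and>
    (\<forall>u\<in>pverts G. \<forall>v\<in>pverts G. \<forall>w\<in>pverts G.
      (u, v) \<notin> parcs G \<longrightarrow> (v, w) \<notin> parcs G \<longrightarrow> (u, w) \<notin> parcs G) \<and>
    (\<forall>u\<in>pverts G. card (part G u) \<in> {1, m}) \<and> card {u \<in> pverts G. card (part G u) = m} = p"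

section \<open>Spectra with eigenvalue n and complete multipartite graphs\<close>

lemma card_part_add_card_nbrs:
  assumes "pair_graph G"
  shows "card (part G u) + card (nbrs G u) = card (pverts G)"
proof -
  have "pverts G = part G u \<union> nbrs G u" "part G u \<inter> nbrs G u = {}" by (auto simp: part_def nbrs_def)
  moreover have "finite (part G u)" using pair_graph_facts(1)[OF assms] by (simp add: part_def)
  ultimately show ?thesis using assms card_Un_disjoint[of "part G u" "nbrs G u"] by simp
qed

text \<open>With \<open>n\<close> as an eigenvalue the diagonal equation factors as
  \<open>(d - c)(d - (n - 1)) = 0\<close>, so every degree is \<open>c\<close> or
  \<open>n - 1\<close>. The trace then counts the vertices of degree \<open>c\<close>; with
  \<open>m = n - c\<close> this count is the identity for \<open>p\<close>.\<close>

lemma uniform_multipartite_if_eigenvalue_eq_order: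
  fixes k l :: nat and c :: real
  assumes G: "pair_graph G" and n: "card (pverts G) = n" "n = k + l + 1" and l: "l > 0"
    and q: "lap_quadratic G n c" and c: "c \<noteq> n"
    and tr: "(\<Sum>u\<in>pverts G. real (card (nbrs G u))) = k * real n + l * c"
  obtains m p where "m \<ge> 2" "c = real n - real m" "p * (m - 1) = l * m" "uniform_multipartite G n m p"
proof -
  let ?V = "pverts G" and ?d = "\<lambda>u. card (nbrs G u)"
  have fin: "finite ?V" using pair_graph_facts(1)[OF G] .
  have n0: "real n > 0" using n by simp
  have deg: "real (?d u) = c \<or> real (?d u) = real n - 1" if "u \<in> ?V" for u
  proof -
    have "(real (?d u) - c) * (real (?d u) - (real n - 1)) = 0"
      using lap_quadraticD(1)[OF q n(1) that] n0 by (simp add: power2_eq_square algebra_simps)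
    then show ?thesis by simp
  qed
  \<comment> \<open>The vertices that are not adjacent to all others.\<close>
  define S where "S = {u \<in> ?V. real (?d u) \<noteq> real n - 1}"
  have "(\<Sum>u\<in>?V. real (?d u)) = (\<Sum>u\<in>?V. real n - 1 - (if real (?d u) \<noteq> real n - 1 then real n - 1 - c else 0))"
    using deg by (intro sum.cong) auto
  also have "\<dots> = real n * (real n - 1) - card S * (real n - 1 - c)"
    using fin n(1) by (simp add: sum_subtractf S_def flip: sum.inter_filter)
  finally have S: "card S * (real n - 1 - c) = l * (real n - c)"
    using tr n(2) by (simp add: algebra_simps)
  moreover have "l * (real n - c) \<noteq> 0" using l c by simp
  \<comment> \<open>The nonzero right-hand side makes \<open>S\<close> nonempty, so \<open>c\<close>
    is the degree of an actual vertex and in particular an integer.\<close>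
  ultimately have "real (card S) * (real n - 1 - c) \<noteq> 0" by (simp only:) simp
  then have nz: "card S \<noteq> 0 \<and> c \<noteq> real n - 1" by (cases "card S = 0") (simp, intro conjI notI, simp_all)
  then have "S \<noteq> {}" by (metis card.empty)
  then obtain u where u: "u \<in> S" by blast
  then have cu: "c = ?d u" using deg by (auto simp: S_def)
  have "?d u < n" using u card_nbrs_less[OF G] n(1) by (auto simp: S_def)
  with conjunct2[OF nz] cu have du: "?d u + 2 \<le> n" by linarith
  define m where "m = n - ?d u"
  have m2: "m \<ge> 2" and cm: "c = real n - real m" using du cu by (auto simp: m_def)
  have part: "card (part G v) = 1 \<longleftrightarrow> real (?d v) = real n - 1" "card (part G v) = m \<longleftrightarrow> real (?d v) \<noteq> real n - 1"
    "card (part G v) \<in> {1, m}" if v: "v \<in> ?V" for v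
  proof -
    have s: "real (card (part G v)) = real n - real (?d v)"
      using card_part_add_card_nbrs[OF G, of v] n(1) by simp
    have "card (part G v) = 1 \<longleftrightarrow> real (card (part G v)) = 1" by simp
    then show 1: "card (part G v) = 1 \<longleftrightarrow> real (?d v) = real n - 1" unfolding s by linarith
    have "card (part G v) = m \<longleftrightarrow> real (card (part G v)) = real m" by simp
    then have "card (part G v) = m \<longleftrightarrow> real (?d v) = c" unfolding s cm by linarith
    then show 2: "card (part G v) = m \<longleftrightarrow> real (?d v) \<noteq> real n - 1" using deg[OF v] conjunct2[OF nz] by metis
    show "card (part G v) \<in> {1, m}" using 1 2 by blast
  qed
  have same: "nbrs G v = nbrs G w" if vw: "v \<in> ?V" "w \<in> ?V" "(v, w) \<notin> parcs G" for v w
  proof (cases "v = w")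
    case False
    \<comment> \<open>A vertex with a nonneighbour besides itself has degree \<open>c\<close>, and
      the number of common neighbours is \<open>n c / n = c\<close> as well, so the inclusion of the
      intersection is an equality.\<close>
    have *: "nbrs G v \<inter> nbrs G w = nbrs G v"
      if vw: "v \<in> ?V" "w \<in> ?V" "(v, w) \<notin> parcs G" "v \<noteq> w" for v w
    proof -
      have "{v, w} \<subseteq> part G v" using vw pair_graph_facts(3)[OF G] by (auto simp: part_def)
      then have "card {v, w} \<le> card (part G v)" using fin by (intro card_mono) (auto simp: part_def)
      then have "card (part G v) \<noteq> 1" using vw(4) by simp
      then have "real (?d v) = c" using part(1)[OF vw(1)] deg[OF vw(1)] by blast
      moreover have "real (card (nbrs G v \<inter> nbrs G w)) = c"
        using lap_quadraticD(3)[OF q n(1) vw(1,4,3,2)] n0 by simp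
      ultimately show ?thesis using G by (intro card_subset_eq) auto
    qed
    have "nbrs G v \<inter> nbrs G w = nbrs G v" using vw False by (rule *)
    moreover have "nbrs G w \<inter> nbrs G v = nbrs G w"
      by (rule *) (use vw False pair_graph_facts(4)[OF G, of v w] in simp_all)
    ultimately show ?thesis by (simp add: Int_commute)
  qed simp
  have "uniform_multipartite G n m (card S)"
    unfolding uniform_multipartite_def
  proof (intro conjI ballI impI G n(1))
    fix u v w assume uvw: "u \<in> ?V" "v \<in> ?V" "w \<in> ?V" "(u, v) \<notin> parcs G" "(v, w) \<notin> parcs G"
    then have "w \<notin> nbrs G v" by (simp add: nbrs_def)
    then have "w \<notin> nbrs G u" using same[OF uvw(1,2,4)] by simp
    then show "(u, w) \<notin> parcs G" using uvw(3) by (simp add: nbrs_def)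
  next
    show "card {u \<in> ?V. card (part G u) = m} = card S"
      using part(2) by (intro arg_cong[of _ _ card]) (auto simp: S_def)
  qed (rule part(3))
  moreover have "card S * (m - 1) = l * m"
  proof -
    have "real (card S * (m - 1)) = real (l * m)" using S cm m2 by (simp add: of_nat_diff)
    then show ?thesis by (simp only: of_nat_eq_iff)
  qed
  ultimately show thesis using that m2 cm by blast
qed

text \<open>The converse by counting: adjacent vertices have as common neighbours everything outside
  their two disjoint parts, and distinct nonadjacent vertices share all \<open>n - m\<close>
  neighbours. The identity for \<open>p\<close> supplies the trace.\<close>

lemma laplacian_spectrum_uniform_multipartite:
  assumes G: "uniform_multipartite G n m p" and m: "m \<ge> 2" "m < n"
    and l: "p * (m - 1) = l * m" "l > 0" and k: "k > 0" "n = k + l + 1"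
  shows "laplacian_spectrum G = replicate_mset k (real n) + replicate_mset l (real n - real m) + {#0#}"
proof -
  let ?V = "pverts G" and ?d = "\<lambda>u. card (nbrs G u)"
  from G have pg: "pair_graph G" and n: "card ?V = n"
    and trans: "\<And>u v w. u \<in> ?V \<Longrightarrow> v \<in> ?V \<Longrightarrow> w \<in> ?V \<Longrightarrow> (u, v) \<notin> parcs G \<Longrightarrow> (v, w) \<notin> parcs G \<Longrightarrow> (u, w) \<notin> parcs G"
    and sizes: "\<And>u. u \<in> ?V \<Longrightarrow> card (part G u) = 1 \<or> card (part G u) = m"
    and p: "card {u \<in> ?V. card (part G u) = m} = p"
    unfolding uniform_multipartite_def by blast+
  have fin: "finite ?V" using pair_graph_facts(1)[OF pg] .
  have sym: "(u, v) \<in> parcs G \<longleftrightarrow> (v, u) \<in> parcs G" for u v using pair_graph_facts(4)[OF pg] .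
  have d: "real (?d u) = real n - real (card (part G u))" for u
    using card_part_add_card_nbrs[OF pg, of u] n by simp
  have cancel: "real n * (real n - real m) / real n = real n - real m" using k(2) by simp
  have "lap_quadratic G n (real n - real m)"
    unfolding lap_quadratic_def Let_def n cancel
  proof (intro conjI ballI impI)
    fix u assume u: "u \<in> ?V"
    show "(real (?d u))\<^sup>2 + real (?d u) - (real n + (real n - real m)) * real (?d u) + real n * (real n - real m)
        = real n - real m"
      using sizes[OF u] k(2) by (elim disjE) (simp_all add: d power2_eq_square algebra_simps)
  next
    fix u v assume uv: "u \<in> ?V" "v \<in> ?V" "(u, v) \<in> parcs G"
    have "part G u \<inter> part G v = {}" using trans[of u _ v] uv sym by (auto simp: part_def)
    then have "card (part G u \<union> part G v) = card (part G u) + card (part G v)"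
      using fin by (intro card_Un_disjoint) (auto simp: part_def)
    moreover have "nbrs G u \<inter> nbrs G v = ?V - (part G u \<union> part G v)" by (auto simp: part_def nbrs_def)
    moreover have "card (?V - (part G u \<union> part G v)) = card ?V - card (part G u \<union> part G v)"
      "card (part G u \<union> part G v) \<le> card ?V"
      using fin by (auto simp: part_def intro!: card_Diff_subset card_mono finite_subset[of _ ?V])
    ultimately have "real (card (nbrs G u \<inter> nbrs G v)) = real n - card (part G u) - card (part G v)"
      using n by simp
    then show "real (card (nbrs G u \<inter> nbrs G v)) - real (?d u) - real (?d v) + real n + (real n - real m)
        = real n - real m"
      using k(2) by (simp add: d)
  next
    fix u v assume uv: "u \<in> ?V" "v \<in> ?V" "u \<noteq> v" "(u, v) \<notin> parcs G"
    have "nbrs G u = nbrs G v" using trans[of u v] trans[of v u] uv sym by (auto simp: nbrs_def)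
    moreover have "{u, v} \<subseteq> part G u" using uv pair_graph_facts(3)[OF pg] by (auto simp: part_def)
    then have "card {u, v} \<le> card (part G u)" using fin by (intro card_mono) (auto simp: part_def)
    then have "card (part G u) = m" using sizes[OF uv(1)] uv(3) by auto
    ultimately show "real (card (nbrs G u \<inter> nbrs G v)) = real n - real m"
      using k(2) d[of u] by simp
  qed
  moreover have "(\<Sum>u\<in>?V. real (?d u)) = k * real n + l * (real n - real m)"
  proof -
    have "(\<Sum>u\<in>?V. real (?d u)) = (\<Sum>u\<in>?V. real n - 1 - (if card (part G u) = m then real m - 1 else 0))"
      using d sizes m(1) by (intro sum.cong) fastforce+
    also have "\<dots> = real n * (real n - 1) - p * (real m - 1)"
      using fin n p by (simp add: sum_subtractf flip: sum.inter_filter)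
    also have "p * (real m - 1) = real (p * (m - 1))" using m by (simp add: of_nat_diff)
    finally show ?thesis unfolding l using k(2) by (simp add: algebra_simps)
  qed
  ultimately show ?thesis
    using laplacian_spectrum_iff[OF pg n k(2,1) l(2), of "real n" "real n - real m"] m by simp
qed

section \<open>Isomorphism of complete multipartite graphs\<close>

lemma pair_graphI:
  assumes "finite (pverts G)" "\<And>u v. (u, v) \<in> parcs G \<Longrightarrow> u \<in> pverts G"
    "\<And>u. (u, u) \<notin> parcs G" "\<And>u v. (u, v) \<in> parcs G \<Longrightarrow> (v, u) \<in> parcs G"
  shows "pair_graph G"
proof
  show "fst e \<in> pverts G" "snd e \<in> pverts G" "fst e \<noteq> snd e" if "e \<in> parcs G" for e
    using that assms by (cases e; fastforce)+
  have "parcs G \<subseteq> pverts G \<times> pverts G"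
    using assms(2) assms(2)[OF assms(4)] by auto
  then show "finite (parcs G)" using assms(1) finite_subset by blast
  show "symmetric G" using assms(4) by (auto simp: symmetric_def intro!: symI)
qed (fact assms(1))

text \<open>Reduces the library's isomorphisms, which carry separate maps for arcs, heads and tails,
  to adjacency-preserving bijections. That \<open>G\<close> is a \<open>pair_graph\<close> is pulled
  back from \<open>H\<close>, because the theorem quantifies over arbitrary
  \<open>G\<close>.\<close>

lemma digraph_iso_pair_graph_iff:
  fixes G :: "'a pair_pre_digraph" and H :: "'b pair_pre_digraph"
  assumes H: "pair_graph H"
  shows "digraph_iso G H \<longleftrightarrow> pair_graph G \<and> (\<exists>f. bij_betw f (pverts G) (pverts H) \<and>
    (\<forall>u\<in>pverts G. \<forall>v\<in>pverts G. (u, v) \<in> parcs G \<longleftrightarrow> (f u, f v) \<in> parcs H))"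
proof
  assume "digraph_iso G H"
  then obtain h where h: "pre_digraph.digraph_isomorphism G h" and HG: "with_proj H = app_iso h G"
    unfolding digraph_iso_def by blast
  define f where "f = iso_verts h"
  have wf: "wf_digraph G" and inj: "inj_on f (pverts G)"
    and ends: "\<And>e. e \<in> parcs G \<Longrightarrow> f (fst e) = iso_tail h (iso_arcs h e) \<and> f (snd e) = iso_head h (iso_arcs h e)"
    using h unfolding pre_digraph.digraph_isomorphism_def f_def by auto
  have V: "pverts H = f ` pverts G" and E: "parcs H = iso_arcs h ` parcs G"
    and t: "iso_tail h = fst" "iso_head h = snd"
    using arg_cong[OF HG, of verts] arg_cong[OF HG, of arcs] arg_cong[OF HG, of tail] arg_cong[OF HG, of head]
    by (simp_all add: f_def)
  have "iso_arcs h e = (f (fst e), f (snd e))" if "e \<in> parcs G" for e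
    using ends[OF that] unfolding t by (simp add: prod_eq_iff)
  then have E: "parcs H = (\<lambda>e. (f (fst e), f (snd e))) ` parcs G" unfolding E by (rule image_cong[OF refl])
  interpret wf: pair_wf_digraph G using wf by (simp add: wf_digraph_wp_iff)
  have iff: "(u, v) \<in> parcs G \<longleftrightarrow> (f u, f v) \<in> parcs H" if "u \<in> pverts G" "v \<in> pverts G" for u v
  proof
    assume "(f u, f v) \<in> parcs H"
    then obtain x y where xy: "(x, y) \<in> parcs G" "f u = f x" "f v = f y" unfolding E by auto
    then have "u = x" "v = y"
      using inj that wf.in_arcsD1[OF xy(1)] wf.in_arcsD2[OF xy(1)] by (auto dest: inj_onD)
    then show "(u, v) \<in> parcs G" using xy by simp
  qed (force simp: E)
  have bij: "bij_betw f (pverts G) (pverts H)" using inj V by (simp add: bij_betw_def)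
  have "pair_graph G"
  proof (rule pair_graphI)
    show "finite (pverts G)" using bij pair_graph_facts(1)[OF H] bij_betw_finite by blast
    show "(u, u) \<notin> parcs G" for u
      using iff[of u u] pair_graph_facts(3)[OF H] wf.in_arcsD1 by blast
    show "(v, u) \<in> parcs G" if "(u, v) \<in> parcs G" for u v
      using that iff[of u v] iff[of v u] pair_graph_facts(4)[OF H, of "f u"] wf.in_arcsD1 wf.in_arcsD2 by blast
  qed (rule wf.in_arcsD1)
  then show "pair_graph G \<and> (\<exists>f. bij_betw f (pverts G) (pverts H) \<and>
    (\<forall>u\<in>pverts G. \<forall>v\<in>pverts G. (u, v) \<in> parcs G \<longleftrightarrow> (f u, f v) \<in> parcs H))" using bij iff by blast
next
  assume "pair_graph G \<and> (\<exists>f. bij_betw f (pverts G) (pverts H) \<and>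
    (\<forall>u\<in>pverts G. \<forall>v\<in>pverts G. (u, v) \<in> parcs G \<longleftrightarrow> (f u, f v) \<in> parcs H))"
  then obtain f where G: "pair_graph G" and bij: "bij_betw f (pverts G) (pverts H)"
    and iff: "\<And>u v. u \<in> pverts G \<Longrightarrow> v \<in> pverts G \<Longrightarrow> (u, v) \<in> parcs G \<longleftrightarrow> (f u, f v) \<in> parcs H" by blast
  interpret G: pair_graph G by fact
  have inj: "inj_on f (pverts G)" and V: "pverts H = f ` pverts G"
    using bij by (auto simp: bij_betw_def)
  have E: "parcs H = map_prod f f ` parcs G"
  proof (intro equalityI subsetI)
    fix e assume e: "e \<in> parcs H"
    then obtain u v where uv: "u \<in> pverts G" "v \<in> pverts G" "e = (f u, f v)"
      using pair_graph_facts(2)[OF H, of "fst e" "snd e"] unfolding V by (cases e) auto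
    then show "e \<in> map_prod f f ` parcs G" using e iff by force
  qed (use iff pair_graph_facts(2)[OF G] in auto)
  define h where "h = \<lparr>iso_verts = f, iso_arcs = map_prod f f, iso_head = snd, iso_tail = fst\<rparr>"
  have "inj_on (map_prod f f) (parcs G)"
    using inj pair_graph_facts(2)[OF G] by (auto simp: inj_on_def)
  then have "pre_digraph.digraph_isomorphism G h"
    unfolding pre_digraph.digraph_isomorphism_def h_def using inj G.wf_digraph by auto
  moreover have "with_proj H = app_iso h G"
    by (simp add: app_iso_def h_def with_proj_def V E)
  ultimately show "digraph_iso G H" unfolding digraph_iso_def by blast
qed

text \<open>Nonadjacency is an equivalence relation here, reflexive because there are no loops, and
  \<open>part G u\<close> is the class of \<open>u\<close>.\<close>

lemma uniform_multipartite_part: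
  assumes "uniform_multipartite G n m p" "u \<in> pverts G"
  shows "u \<in> part G u" "v \<in> pverts G \<Longrightarrow> part G u = part G v \<longleftrightarrow> (u, v) \<notin> parcs G"
    "part G u \<inter> part G v \<noteq> {} \<Longrightarrow> v \<in> pverts G \<Longrightarrow> part G u = part G v"
proof -
  have G: "pair_graph G" and
    trans: "\<And>u v w. u \<in> pverts G \<Longrightarrow> v \<in> pverts G \<Longrightarrow> w \<in> pverts G \<Longrightarrow>
      (u, v) \<notin> parcs G \<Longrightarrow> (v, w) \<notin> parcs G \<Longrightarrow> (u, w) \<notin> parcs G"
    using assms(1) unfolding uniform_multipartite_def by blast+
  note sym = pair_graph_facts(4)[OF G] and irr = pair_graph_facts(3)[OF G]
  show "u \<in> part G u" using irr assms(2) by (auto simp: part_def)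
  show eq: "part G u = part G v \<longleftrightarrow> (u, v) \<notin> parcs G" if "v \<in> pverts G" for v
  proof
    assume "part G u = part G v"
    moreover have "v \<in> part G v" using irr that by (auto simp: part_def)
    ultimately show "(u, v) \<notin> parcs G" by (auto simp: part_def)
  next
    assume "(u, v) \<notin> parcs G"
    then show "part G u = part G v"
      using trans[of u v] trans[of v u] sym[of u v] assms(2) that by (auto simp: part_def)
  qed
  assume "part G u \<inter> part G v \<noteq> {}" and v: "v \<in> pverts G"
  then obtain w where w: "w \<in> pverts G" "(u, w) \<notin> parcs G" "(v, w) \<notin> parcs G" by (auto simp: part_def)
  have "(u, v) \<notin> parcs G" by (rule trans[of u w v]) (use w v assms(2) sym[of w v] in auto)
  then show "part G u = part G v" using eq v by simp
qed

lemma uniform_multipartite_cong_iso: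
  fixes G :: "'a pair_pre_digraph" and H :: "'b pair_pre_digraph"
  assumes H: "uniform_multipartite H n m p" and iso: "digraph_iso G H"
  shows "uniform_multipartite G n m p"
proof -
  have "pair_graph H" using H by (simp add: uniform_multipartite_def)
  from iso[unfolded digraph_iso_pair_graph_iff[OF this]]
  obtain f where G: "pair_graph G" and bij: "bij_betw f (pverts G) (pverts H)"
    and iff: "\<And>u v. u \<in> pverts G \<Longrightarrow> v \<in> pverts G \<Longrightarrow> (u, v) \<in> parcs G \<longleftrightarrow> (f u, f v) \<in> parcs H" by blast
  have trans: "\<And>u v w. u \<in> pverts H \<Longrightarrow> v \<in> pverts H \<Longrightarrow> w \<in> pverts H \<Longrightarrow>
      (u, v) \<notin> parcs H \<Longrightarrow> (v, w) \<notin> parcs H \<Longrightarrow> (u, w) \<notin> parcs H"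
    and p: "card {u \<in> pverts H. card (part H u) = m} = p"
    using H unfolding uniform_multipartite_def by blast+
  have inj: "inj_on f (pverts G)" and V: "pverts H = f ` pverts G"
    using bij by (auto simp: bij_betw_def)
  have mem: "f u \<in> pverts H" if "u \<in> pverts G" for u using that V by simp
  have part: "card (part G u) = card (part H (f u))" if "u \<in> pverts G" for u
  proof -
    have "part H (f u) = f ` part G u" using that iff by (auto simp: part_def V)
    moreover have "inj_on f (part G u)" using inj by (rule inj_on_subset) (auto simp: part_def)
    ultimately show ?thesis by (simp add: card_image)
  qed
  show ?thesis
    unfolding uniform_multipartite_def
  proof (intro conjI ballI impI G)
    show "card (pverts G) = n" using bij_betw_same_card[OF bij] H by (simp add: uniform_multipartite_def)
  next
    fix u v w assume uvw: "u \<in> pverts G" "v \<in> pverts G" "w \<in> pverts G" "(u, v) \<notin> parcs G" "(v, w) \<notin> parcs G"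
    have "(f u, f w) \<notin> parcs H"
      by (rule trans[of "f u" "f v" "f w"]) (use uvw iff mem in simp_all)
    then show "(u, w) \<notin> parcs G" using uvw iff by simp
  next
    fix u assume "u \<in> pverts G"
    then show "card (part G u) \<in> {1, m}" using part mem H unfolding uniform_multipartite_def by simp
  next
    have "f ` {u \<in> pverts G. card (part G u) = m} = {u \<in> pverts H. card (part H u) = m}"
      using part by (auto simp: V)
    moreover have "inj_on f {u \<in> pverts G. card (part G u) = m}" using inj by (rule inj_on_subset) auto
    ultimately show "card {u \<in> pverts G. card (part G u) = m} = p"
      using p by (simp flip: card_image[of f])
  qed
qed

text \<open>The parameter \<open>p\<close> counts vertices, not parts; the disjointness of the parts
  converts one count into the other.\<close>

lemma uniform_multipartite_card_parts:
  assumes G: "uniform_multipartite G n m p" and s: "s > 0"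
  shows "s * card {C \<in> part G ` pverts G. card C = s} = card {u \<in> pverts G. card (part G u) = s}"
proof -
  have fin: "finite (pverts G)" using G pair_graph_facts(1) by (auto simp: uniform_multipartite_def)
  have U: "\<Union> {C \<in> part G ` pverts G. card C = s} = {u \<in> pverts G. card (part G u) = s}" (is "?U = ?S")
  proof (intro equalityI subsetI)
    fix x assume "x \<in> ?U"
    then obtain u where u: "u \<in> pverts G" "x \<in> part G u" "card (part G u) = s" by auto
    then have x: "x \<in> pverts G" by (simp add: part_def)
    then have "part G u = part G x"
      using uniform_multipartite_part(3)[OF G u(1)] uniform_multipartite_part(1)[OF G x] u(2) by blast
    then show "x \<in> ?S" using x u(3) by simp
  qed (use uniform_multipartite_part(1)[OF G] in auto)
  have "s * card {C \<in> part G ` pverts G. card C = s} = card (\<Union> {C \<in> part G ` pverts G. card C = s})"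
  proof (rule card_partition)
    show "finite (\<Union> {C \<in> part G ` pverts G. card C = s})" unfolding U using fin by simp
    show "C \<inter> D = {}" if "C \<in> {C \<in> part G ` pverts G. card C = s}" "D \<in> {C \<in> part G ` pverts G. card C = s}"
      "C \<noteq> D" for C D
      using that uniform_multipartite_part(3)[OF G] by blast
  qed (use fin in auto)
  then show ?thesis unfolding U .
qed

lemma uniform_multipartite_card_singleton_parts:
  assumes G: "uniform_multipartite G n m p" and m: "m \<ge> 2"
  shows "card {u \<in> pverts G. card (part G u) = 1} = n - p"
proof -
  have "finite (pverts G)" using G pair_graph_facts(1) by (auto simp: uniform_multipartite_def)
  moreover have "{u \<in> pverts G. card (part G u) = 1} = pverts G - {u \<in> pverts G. card (part G u) = m}"
    using G m by (auto simp: uniform_multipartite_def)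
  ultimately show ?thesis using G by (simp add: uniform_multipartite_def card_Diff_subset)
qed

text \<open>The parameters fix the number of parts of each size. A bijection \<open>g\<close>
  matches parts of equal size, and bijections within matched parts are glued together;
  \<open>m >= 2\<close> keeps the sizes 1 and \<open>m\<close> apart.\<close>

lemma uniform_multipartite_iso:
  fixes G :: "'a pair_pre_digraph" and H :: "'b pair_pre_digraph"
  assumes G: "uniform_multipartite G n m p" and H: "uniform_multipartite H n m p" and m: "m \<ge> 2"
  shows "digraph_iso G H"
proof -
  have pG: "pair_graph G" and pH: "pair_graph H" using G H by (auto simp: uniform_multipartite_def)
  have fG: "finite (pverts G)" and fH: "finite (pverts H)" using pair_graph_facts(1) pG pH by blast+
  have sizes: "\<And>u. u \<in> pverts G \<Longrightarrow> card (part G u) = 1 \<or> card (part G u) = m"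
    "\<And>u. u \<in> pverts H \<Longrightarrow> card (part H u) = 1 \<or> card (part H u) = m"
    using G H unfolding uniform_multipartite_def by blast+
  define P where "P s = {C \<in> part G ` pverts G. card C = s}" for s
  define Q where "Q s = {C \<in> part H ` pverts H. card C = s}" for s
  have finPQ: "finite (P s)" "finite (Q s)" for s using fG fH by (simp_all add: P_def Q_def)
  have "card (P 1) = card (Q 1)"
    using uniform_multipartite_card_parts[OF G, of 1] uniform_multipartite_card_parts[OF H, of 1]
      uniform_multipartite_card_singleton_parts[OF G m] uniform_multipartite_card_singleton_parts[OF H m] by (simp add: P_def Q_def)
  then obtain g1 where g1: "bij_betw g1 (P 1) (Q 1)"
    using finPQ finite_same_card_bij by blast
  have "m * card (P m) = m * card (Q m)"
    using uniform_multipartite_card_parts[OF G, of m] uniform_multipartite_card_parts[OF H, of m] m G H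
    by (simp add: P_def Q_def uniform_multipartite_def)
  then have "card (P m) = card (Q m)" using m by simp
  then obtain gm where gm: "bij_betw gm (P m) (Q m)"
    using finPQ finite_same_card_bij by blast
  define g where "g C = (if card C = 1 then g1 C else gm C)" for C
  have "bij_betw g (P 1) (Q 1)" using g1 bij_betw_cong[of "P 1" g g1 "Q 1"] by (simp add: g_def P_def)
  moreover have "bij_betw g (P m) (Q m)"
    using gm bij_betw_cong[of "P m" g gm "Q m"] m by (simp add: g_def P_def)
  moreover have "Q 1 \<inter> Q m = {}" using m by (auto simp: Q_def)
  ultimately have "bij_betw g (P 1 \<union> P m) (Q 1 \<union> Q m)" by (rule bij_betw_combine)
  moreover have "P 1 \<union> P m = part G ` pverts G" "Q 1 \<union> Q m = part H ` pverts H"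
    using sizes by (auto simp: P_def Q_def)
  ultimately have g: "bij_betw g (part G ` pverts G) (part H ` pverts H)" by simp
  have gcard: "card (g (part G u)) = card (part G u)" if "u \<in> pverts G" for u
  proof (cases "card (part G u) = 1")
    case True
    then have "g1 (part G u) \<in> Q 1" using that g1 by (auto simp: P_def dest!: bij_betw_apply)
    then show ?thesis using True by (simp add: g_def Q_def)
  next
    case False
    then have "card (part G u) = m" using sizes(1)[OF that] by simp
    moreover from this have "gm (part G u) \<in> Q m" using that gm by (auto simp: P_def dest!: bij_betw_apply)
    ultimately show ?thesis using False by (simp add: g_def Q_def)
  qed
  have gpart: "\<exists>w\<in>pverts H. g (part G u) = part H w" if "u \<in> pverts G" for u
    using that bij_betw_apply[OF g, of "part G u"] by auto
  have "\<exists>h. bij_betw h (part G u) (g (part G u))" if "u \<in> pverts G" for u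
  proof -
    have "finite (part G u)" using fG by (simp add: part_def)
    moreover have "finite (g (part G u))" using gpart[OF that] fH by (auto simp: part_def)
    ultimately show ?thesis using gcard[OF that] by (intro finite_same_card_bij) auto
  qed
  then have "\<forall>C\<in>part G ` pverts G. \<exists>h. bij_betw h C (g C)" by blast
  from bchoice[OF this] obtain h where h: "\<And>C. C \<in> part G ` pverts G \<Longrightarrow> bij_betw (h C) C (g C)" by blast
  \<comment> \<open>Each vertex is moved by the bijection of its own part, so \<open>f\<close> maps
    parts to parts. Adjacency depends on the parts alone and is preserved.\<close>
  define f where "f u = h (part G u) u" for u
  have f_in: "f u \<in> g (part G u)" if "u \<in> pverts G" for u
    using that bij_betw_apply[OF h[of "part G u"]] uniform_multipartite_part(1)[OF G] by (simp add: f_def)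
  have f_verts: "f u \<in> pverts H" if "u \<in> pverts G" for u
    using f_in[OF that] gpart[OF that] by (auto simp: part_def)
  have part_f: "part H (f u) = g (part G u)" if u: "u \<in> pverts G" for u
  proof -
    obtain w where w: "w \<in> pverts H" "g (part G u) = part H w" using gpart[OF u] by blast
    have "part H (f u) \<inter> part H w \<noteq> {}"
      using uniform_multipartite_part(1)[OF H f_verts[OF u]] f_in[OF u] w by auto
    then show ?thesis using uniform_multipartite_part(3)[OF H f_verts[OF u] _ w(1)] w by simp
  qed
  have eq_iff: "g (part G u) = g (part G v) \<longleftrightarrow> part G u = part G v" if "u \<in> pverts G" "v \<in> pverts G" for u v
    using that bij_betw_imp_inj_on[OF g] by (auto dest: inj_onD)
  have "bij_betw f (pverts G) (pverts H)"
    unfolding bij_betw_def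
  proof (intro conjI inj_onI equalityI subsetI)
    fix u v assume uv: "u \<in> pverts G" "v \<in> pverts G" "f u = f v"
    then have "g (part G u) = g (part G v)" using part_f[OF uv(1)] part_f[OF uv(2)] by simp
    then have "part G u = part G v" using eq_iff uv by simp
    moreover from this have "u \<in> part G u" "v \<in> part G u"
      using uniform_multipartite_part(1)[OF G] uv by auto
    ultimately show "u = v"
      using uv(3) bij_betw_imp_inj_on[OF h[of "part G u"]] uv(1) by (auto simp: f_def dest: inj_onD)
  next
    fix w assume w: "w \<in> pverts H"
    then have "part H w \<in> g ` part G ` pverts G" using bij_betw_imp_surj_on[OF g] by simp
    then obtain u where u: "u \<in> pverts G" "part H w = g (part G u)" by auto
    have "w \<in> g (part G u)" using uniform_multipartite_part(1)[OF H w] u by simp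
    then have "w \<in> h (part G u) ` part G u" using bij_betw_imp_surj_on[OF h[of "part G u"]] u by simp
    then obtain v where v: "v \<in> part G u" "w = h (part G u) v" by blast
    then have "v \<in> pverts G" by (simp add: part_def)
    moreover from this have "part G u = part G v"
      using uniform_multipartite_part(3)[OF G u(1)] uniform_multipartite_part(1)[OF G] v(1) by blast
    ultimately show "w \<in> f ` pverts G" using v(2) by (auto simp: f_def)
  qed (use f_verts in auto)
  moreover have "(u, v) \<in> parcs G \<longleftrightarrow> (f u, f v) \<in> parcs H" if uv: "u \<in> pverts G" "v \<in> pverts G" for u v
    using uniform_multipartite_part(2)[OF G uv] uniform_multipartite_part(2)[OF H f_verts[OF uv(1)] f_verts[OF uv(2)]]
      part_f eq_iff uv by simp
  ultimately show ?thesis unfolding digraph_iso_pair_graph_iff[OF pH] using pG by blast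
qed

section \<open>The graphs of the classification\<close>

text \<open>Turns every isomorphism in the classification into a comparison of three
  numbers.\<close>

lemma digraph_iso_uniform_multipartite_iff:
  fixes G :: "'a pair_pre_digraph" and H :: "'b pair_pre_digraph"
  assumes "uniform_multipartite H n m p" "m \<ge> 2"
  shows "digraph_iso G H \<longleftrightarrow> uniform_multipartite G n m p"
  using uniform_multipartite_cong_iso[OF assms(1)] uniform_multipartite_iso[OF _ assms] by blast

text \<open>All edges run between the two sides, so the parts of a join are the parts of its
  operands, and the counts add up for a common \<open>m\<close>.\<close>

lemma uniform_multipartite_join:
  assumes G: "uniform_multipartite G n m p" and H: "uniform_multipartite H n' m p'"
  shows "uniform_multipartite (G \<nabla> H) (n + n') m (p + p')"
proof -
  let ?J = "G \<nabla> H"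
  have pG: "pair_graph G" and pH: "pair_graph H" using G H by (auto simp: uniform_multipartite_def)
  have fG: "finite (pverts G)" and fH: "finite (pverts H)" using pair_graph_facts(1) pG pH by blast+
  have arcs: "(Inl u, Inl v) \<in> parcs ?J \<longleftrightarrow> (u, v) \<in> parcs G" "(Inr x, Inr y) \<in> parcs ?J \<longleftrightarrow> (x, y) \<in> parcs H"
    "(Inl u, Inr x) \<in> parcs ?J \<longleftrightarrow> u \<in> pverts G \<and> x \<in> pverts H"
    "(Inr x, Inl u) \<in> parcs ?J \<longleftrightarrow> u \<in> pverts G \<and> x \<in> pverts H" for u v x y
    by (auto simp: graph_join_def)
  have V: "pverts ?J = pverts G <+> pverts H" by (simp add: graph_join_def)
  have mem: "Inl u \<in> pverts ?J \<longleftrightarrow> u \<in> pverts G" "Inr x \<in> pverts ?J \<longleftrightarrow> x \<in> pverts H" for u x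
    by (auto simp: V)
  have "pair_graph ?J"
  proof (rule pair_graphI)
    show "finite (pverts ?J)" using fG fH by (simp add: V)
    show "u \<in> pverts ?J" if "(u, v) \<in> parcs ?J" for u v
      using that pair_graph_facts(2)[OF pG] pair_graph_facts(2)[OF pH]
      by (cases u; cases v) (auto simp: arcs mem)
    show "(u, u) \<notin> parcs ?J" for u
      using pair_graph_facts(3)[OF pG] pair_graph_facts(3)[OF pH] by (cases u) (auto simp: arcs)
    show "(v, u) \<in> parcs ?J" if "(u, v) \<in> parcs ?J" for u v
      using that pair_graph_facts(4)[OF pG] pair_graph_facts(4)[OF pH]
      by (cases u; cases v) (auto simp: arcs)
  qed
  moreover have "card (pverts ?J) = n + n'"
    using G H fG fH by (simp add: V card_Plus uniform_multipartite_def)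
  moreover have trans: "(u, w) \<notin> parcs ?J"
    if uvw: "u \<in> pverts ?J" "v \<in> pverts ?J" "w \<in> pverts ?J" "(u, v) \<notin> parcs ?J" "(v, w) \<notin> parcs ?J" for u v w
  proof -
    have tG: "\<And>u v w. u \<in> pverts G \<Longrightarrow> v \<in> pverts G \<Longrightarrow> w \<in> pverts G \<Longrightarrow>
        (u, v) \<notin> parcs G \<Longrightarrow> (v, w) \<notin> parcs G \<Longrightarrow> (u, w) \<notin> parcs G"
      using G unfolding uniform_multipartite_def by blast
    have tH: "\<And>u v w. u \<in> pverts H \<Longrightarrow> v \<in> pverts H \<Longrightarrow> w \<in> pverts H \<Longrightarrow>
        (u, v) \<notin> parcs H \<Longrightarrow> (v, w) \<notin> parcs H \<Longrightarrow> (u, w) \<notin> parcs H"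
      using H unfolding uniform_multipartite_def by blast
    show ?thesis
    proof (cases v)
      case (Inl v')
      with uvw obtain u' w' where "u = Inl u'" "w = Inl w'"
        by (cases u; cases w) (simp_all add: arcs mem)
      then show ?thesis using uvw Inl tG[of u' v' w'] by (simp add: arcs mem)
    next
      case (Inr v')
      with uvw obtain u' w' where "u = Inr u'" "w = Inr w'"
        by (cases u; cases w) (simp_all add: arcs mem)
      then show ?thesis using uvw Inr tH[of u' v' w'] by (simp add: arcs mem)
    qed
  qed
  have partL: "card (part ?J (Inl u)) = card (part G u)" if "u \<in> pverts G" for u
  proof -
    have "part ?J (Inl u) = Inl ` part G u" proof (rule Set.set_eqI)
      fix v show "v \<in> part ?J (Inl u) \<longleftrightarrow> v \<in> Inl ` part G u"
        using that by (cases v) (auto simp: part_def arcs mem)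
    qed
    then show ?thesis by (simp add: card_image)
  qed
  have partR: "card (part ?J (Inr u)) = card (part H u)" if "u \<in> pverts H" for u
  proof -
    have "part ?J (Inr u) = Inr ` part H u" proof (rule Set.set_eqI)
      fix v show "v \<in> part ?J (Inr u) \<longleftrightarrow> v \<in> Inr ` part H u"
        using that by (cases v) (auto simp: part_def arcs mem)
    qed
    then show ?thesis by (simp add: card_image)
  qed
  moreover have "card {u \<in> pverts ?J. card (part ?J u) = m} = p + p'"
  proof -
    have "{u \<in> pverts ?J. card (part ?J u) = m} =
        {u \<in> pverts G. card (part G u) = m} <+> {u \<in> pverts H. card (part H u) = m}"
    proof (rule Set.set_eqI)
      fix u show "u \<in> {u \<in> pverts ?J. card (part ?J u) = m} \<longleftrightarrow>
          u \<in> {u \<in> pverts G. card (part G u) = m} <+> {u \<in> pverts H. card (part H u) = m}"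
        by (cases u) (auto simp: mem partL partR)
    qed
    then show ?thesis using G H fG fH by (simp add: card_Plus uniform_multipartite_def)
  qed
  moreover have "card (part ?J u) \<in> {1, m}" if "u \<in> pverts ?J" for u
  proof (cases u)
    case (Inl u')
    then show ?thesis using that partL[of u'] G by (simp add: mem uniform_multipartite_def)
  next
    case (Inr u')
    then show ?thesis using that partR[of u'] H by (simp add: mem uniform_multipartite_def)
  qed
  ultimately show ?thesis
    unfolding uniform_multipartite_def
  proof (intro conjI ballI impI)
    fix u v w assume "u \<in> pverts ?J" "v \<in> pverts ?J" "w \<in> pverts ?J" "(u, v) \<notin> parcs ?J" "(v, w) \<notin> parcs ?J"
    then show "(u, w) \<notin> parcs ?J" by (rule trans)
  qed
qed

text \<open>The size \<open>m\<close> is left free so that a complete graph can be joined to a graph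
  with any part size; \<open>m >= 2\<close> makes the count 0, since all parts are
  singletons.\<close>

lemma uniform_multipartite_complete:
  assumes "m \<ge> 2"
  shows "uniform_multipartite (complete_pgraph r) r m 0"
proof -
  have "part (complete_pgraph r) u = {u}" if "u < r" for u
    using that by (auto simp: part_def complete_pgraph_def)
  then have 1: "card (part (complete_pgraph r) u) = 1" if "u < r" for u
    using that by simp
  have "pair_graph (complete_pgraph r)" by (rule pair_graphI) (auto simp: complete_pgraph_def)
  then show ?thesis
    using 1 assms by (auto simp: uniform_multipartite_def) (auto simp: complete_pgraph_def)
qed

lemma uniform_multipartite_edgeless: "uniform_multipartite (edgeless_pgraph k) k k k"
proof -
  have 1: "part (edgeless_pgraph k) u = {..<k}" for u
    by (auto simp: part_def edgeless_pgraph_def)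
  have "pair_graph (edgeless_pgraph k)" by (rule pair_graphI) (auto simp: edgeless_pgraph_def)
  then show ?thesis by (simp add: uniform_multipartite_def 1) (simp add: edgeless_pgraph_def lessThan_def)
qed

lemma uniform_multipartite_complete_multipartite:
  "uniform_multipartite (complete_multipartite_pgraph (replicate q m)) (q * m) m (q * m)"
proof -
  let ?G = "complete_multipartite_pgraph (replicate q m)"
  have V: "pverts ?G = {..<q} \<times> {..<m}" and E: "parcs ?G = {(u, v). u \<in> pverts ?G \<and> v \<in> pverts ?G \<and> fst u \<noteq> fst v}"
    by (auto simp: complete_multipartite_pgraph_def Let_def)
  have "part ?G u = {fst u} \<times> {..<m}" if "u \<in> pverts ?G" for u
    using that by (auto simp: part_def E V)
  then have 1: "card (part ?G u) = m" if "u \<in> pverts ?G" for u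
    using that by (simp add: card_cartesian_product)
  have "pair_graph ?G" by (rule pair_graphI) (auto simp: E V)
  moreover have "{u \<in> pverts ?G. card (part ?G u) = m} = pverts ?G" using 1 by auto
  moreover have "card (pverts ?G) = q * m" by (simp add: V card_cartesian_product)
  ultimately show ?thesis using 1 unfolding uniform_multipartite_def by (auto simp: E)
qed

text \<open>The 4-cycle is the complete bipartite graph with two parts of size 2, its pairs of
  opposite vertices.\<close>

lemma uniform_multipartite_cycle_4: "uniform_multipartite (cycle_pgraph 4) 4 2 4"
proof -
  let ?G = "cycle_pgraph 4"
  have V: "pverts ?G = {0, 1, 2, 3}" by (auto simp: cycle_pgraph_def)
  have E: "parcs ?G = {(0, 1), (1, 0), (1, 2), (2, 1), (2, 3), (3, 2), (3, 0), (0, 3)}" (is "_ = ?E")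
  proof (intro equalityI subsetI)
    fix e assume "e \<in> parcs ?G"
    then obtain i j where e: "e = (i, j)" "i < 4" "j < 4" "j = Suc i mod 4 \<or> i = Suc j mod 4"
      by (auto simp: cycle_pgraph_def)
    then have "i = 0 \<or> i = 1 \<or> i = 2 \<or> i = 3" "j = 0 \<or> j = 1 \<or> j = 2 \<or> j = 3" by auto
    then show "e \<in> ?E" using e(1,4) by (elim disjE) simp_all
  qed (auto simp: cycle_pgraph_def)
  have "part ?G 0 = {0, 2}" "part ?G 1 = {1, 3}" "part ?G 2 = {0, 2}" "part ?G 3 = {1, 3}"
    by (auto simp: part_def E V)
  then have 2: "card (part ?G u) = 2" if "u \<in> pverts ?G" for u using that by (auto simp: V)
  have "pair_graph ?G" by (rule pair_graphI) (auto simp: E V)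
  moreover have "{u \<in> pverts ?G. card (part ?G u) = 2} = pverts ?G" using 2 by auto
  moreover have "card (pverts ?G) = 4" by (simp add: V)
  ultimately show ?thesis using 2 unfolding uniform_multipartite_def by (auto simp: E V)
qed

lemma uniform_multipartite_connected:
  assumes G: "uniform_multipartite G n m p" and m: "1 \<le> m" "m < n"
  shows "Digraph_Component.connected G"
proof -
  from G have pg: "pair_graph G" and n: "card (pverts G) = n" by (auto simp: uniform_multipartite_def)
  interpret pair_graph G by fact
  have fin: "finite (pverts G)" using pair_graph_facts(1)[OF pg] .
  have reach: "u \<rightarrow>\<^sup>*\<^bsub>with_proj G\<^esub> v" if uv: "u \<in> pverts G" "v \<in> pverts G" for u v
  proof (cases "(u, v) \<in> parcs G")
    case False
    \<comment> \<open>Every part is smaller than the graph, so some vertex lies outside the part of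
      \<open>u\<close>. A nonadjacent \<open>v\<close> shares that part, and the outside vertex
      links both by a path of length two.\<close>
    have "card (part G u) < card (pverts G)" using G uv(1) m n by (auto simp: uniform_multipartite_def)
    then have "part G u \<noteq> pverts G" by auto
    then obtain w where w: "w \<in> pverts G" "w \<notin> part G u" by (auto simp: part_def)
    then have uw: "(u, w) \<in> parcs G" by (simp add: part_def)
    have "w \<notin> part G v" using uniform_multipartite_part(2)[OF G uv] False w(2) by simp
    then have "(v, w) \<in> parcs G" using w(1) by (simp add: part_def)
    then have wv: "(w, v) \<in> parcs G" using pair_graph_facts(4)[OF pg] by blast
    have "u \<rightarrow>\<^sup>*\<^bsub>with_proj G\<^esub> w" "w \<rightarrow>\<^sup>*\<^bsub>with_proj G\<^esub> v" using uw wv by (simp_all add: reachable_adjI)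
    then show ?thesis by (rule reachable_trans)
  qed (simp add: reachable_adjI)
  have "pverts G \<noteq> {}" using n m by auto
  then show ?thesis
    using reach sym_arcs by (intro connectedI) (simp_all add: reachable_mk_symmetric_eq)
qed

section \<open>Membership in the two classes\<close>

lemma lap_quadratic_commute: "lap_quadratic G a b \<longleftrightarrow> lap_quadratic G b a"
  by (simp add: lap_quadratic_def Let_def algebra_simps)

text \<open>The order of \<open>a\<close> and \<open>b\<close> is left open so that both classes can
  use this, with \<open>b\<close> always the double eigenvalue. Each class then discards the
  alternative that contradicts its own order.\<close>

lemma double_eigenvalue_imp_uniform_multipartite:
  fixes G :: "'a pair_pre_digraph"
  assumes G: "pair_graph G" and n: "card (pverts G) = n" "n \<ge> 6"
    and spec: "laplacian_spectrum G = replicate_mset (n - 3) a + replicate_mset 2 b + {#0#}"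
    and ab: "a > 0" "b > 0" "a \<noteq> b"
  obtains (many) m p where "a = n" "b < n" "m \<ge> 2" "p * (m - 1) = 2 * m" "uniform_multipartite G n m p"
    | (two) m p where "b = n" "a < n" "m \<ge> 2" "p * (m - 1) = (n - 3) * m" "uniform_multipartite G n m p"
proof -
  have q: "lap_quadratic G a b" and tr: "(\<Sum>u\<in>pverts G. real (card (nbrs G u))) = real (n - 3) * a + real 2 * b"
    using laplacian_spectrum_iff[OF G n(1), of "n - 3" 2 a b] spec ab n(2) by auto
  have "(\<Sum>u\<in>pverts G. real (card (nbrs G u))) = (real n - 3) * a + 2 * b" using tr n(2) by simp
  from eigenvalue_eq_order[OF G n q ab this] show thesis
  proof
    assume a: "a = n"
    have "n = n - 3 + 2 + 1" "(2::nat) > 0" "b \<noteq> n" using n(2) a ab by auto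
    from uniform_multipartite_if_eigenvalue_eq_order[OF G n(1) this(1,2) q[unfolded a] this(3) tr[unfolded a]]
    obtain m p where "m \<ge> 2" "b = real n - real m" "p * (m - 1) = 2 * m" "uniform_multipartite G n m p" .
    then show thesis using many a by simp
  next
    assume b: "b = n"
    have q': "lap_quadratic G n a" using q by (simp add: b lap_quadratic_commute)
    have tr': "(\<Sum>u\<in>pverts G. real (card (nbrs G u))) = real 2 * real n + real (n - 3) * a"
      using tr by (simp add: b)
    have "n = 2 + (n - 3) + 1" "n - 3 > 0" "a \<noteq> n" using n(2) b ab by auto
    from uniform_multipartite_if_eigenvalue_eq_order[OF G n(1) this(1,2) q' this(3) tr']
    obtain m p where "m \<ge> 2" "a = real n - real m" "p * (m - 1) = (n - 3) * m" "uniform_multipartite G n m p" .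
    then show thesis using two b by simp
  qed
qed

lemma G1_class_iff:
  assumes n: "n \<ge> 6"
  shows "G \<in> G1_class n \<longleftrightarrow> uniform_multipartite G n 3 3 \<or> uniform_multipartite G n 2 4"
proof
  assume "G \<in> G1_class n"
  then obtain a b where G: "pair_graph G" "card (pverts G) = n" and ab: "a > b" "b > 0"
    and spec: "laplacian_spectrum G = replicate_mset (n - 3) a + replicate_mset 2 b + {#0#}"
    unfolding G1_class_def connected_graph_on_def by blast
  have pos: "a > 0" "a \<noteq> b" using ab by auto
  show "uniform_multipartite G n 3 3 \<or> uniform_multipartite G n 2 4"
  proof (rule double_eigenvalue_imp_uniform_multipartite[OF G n spec pos(1) ab(2) pos(2)])
    fix m p assume many: "m \<ge> 2" "p * (m - 1) = 2 * m" "uniform_multipartite G n m p"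
    \<comment> \<open>Avoids natural subtraction. The identity forces \<open>p > 2\<close>, hence
      \<open>3 (m - 1) <= 2 m\<close>, that is \<open>m <= 3\<close>.\<close>
    obtain k where k: "m = k + 2" using many(1) by (metis add.commute le_Suc_ex)
    have *: "p * (k + 1) = 2 * (k + 2)" using many(2) by (simp add: k)
    have "k < 2"
    proof (rule ccontr)
      assume "\<not> k < 2"
      have "p > 2"
      proof (rule ccontr)
        assume "\<not> p > 2"
        then have "p * (k + 1) \<le> 2 * (k + 1)" by (intro mult_le_mono1) simp
        then show False using * by simp
      qed
      then have "3 * (k + 1) \<le> p * (k + 1)" by (intro mult_le_mono1) simp
      then show False using * \<open>\<not> k < 2\<close> by simp
    qed
    then have "k = 0 \<or> k = 1" by auto
    then have "m = 2 \<and> p = 4 \<or> m = 3 \<and> p = 3" using * k by auto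
    then show "uniform_multipartite G n 3 3 \<or> uniform_multipartite G n 2 4" using many(3) by auto
  qed (use ab in simp)
next
  assume *: "uniform_multipartite G n 3 3 \<or> uniform_multipartite G n 2 4"
  \<comment> \<open>Both families satisfy the same trace identity, so spectrum and connectedness are
    derived once.\<close>
  then obtain m p where mp: "m \<ge> 2" "m < n" "p * (m - 1) = 2 * m" and G: "uniform_multipartite G n m p"
  proof (elim disjE)
    assume "uniform_multipartite G n 3 3" then show thesis using that[of 3 3] n by simp
  next
    assume "uniform_multipartite G n 2 4" then show thesis using that[of 2 4] n by simp
  qed
  have "laplacian_spectrum G = replicate_mset (n - 3) (real n) + replicate_mset 2 (real n - real m) + {#0#}"
    by (rule laplacian_spectrum_uniform_multipartite[OF G mp]) (use n in auto)
  moreover have "real n > real n - real m" "real n - real m > 0" using mp by auto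
  moreover have "connected_graph_on n G"
    using uniform_multipartite_connected[OF G] mp G unfolding connected_graph_on_def uniform_multipartite_def by auto
  ultimately show "G \<in> G1_class n" unfolding G1_class_def by blast
qed

lemma G2_class_iff:
  assumes n: "n \<ge> 6"
  shows "G \<in> G2_class n \<longleftrightarrow> uniform_multipartite G n (n - 2) (n - 2) \<or>
    odd n \<and> uniform_multipartite G n ((n - 1) div 2) (n - 1) \<or> 3 dvd n \<and> uniform_multipartite G n (n div 3) n"
    (is "_ \<longleftrightarrow> ?rhs")
proof
  assume "G \<in> G2_class n"
  then obtain a b where G: "pair_graph G" "card (pverts G) = n" and ab: "a > b" "b > 0"
    and "laplacian_spectrum G = replicate_mset 2 a + replicate_mset (n - 3) b + {#0#}"
    unfolding G2_class_def connected_graph_on_def by blast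
  then have spec: "laplacian_spectrum G = replicate_mset (n - 3) b + replicate_mset 2 a + {#0#}"
    by (simp add: add.commute)
  have pos: "a > 0" "b \<noteq> a" using ab by auto
  show ?rhs
  proof (rule double_eigenvalue_imp_uniform_multipartite[OF G n spec ab(2) pos])
    fix m p assume two: "m \<ge> 2" "p * (m - 1) = (n - 3) * m" "uniform_multipartite G n m p"
    \<comment> \<open>Coprimality extracts the number \<open>q\<close> of parts of size
      \<open>m\<close> from the trace identity, giving \<open>q (m - 1) = n - 3\<close>.\<close>
    have "coprime m (m - 1)" using two(1) coprime_diff_one_right_nat[of m] by simp
    moreover have "m dvd p * (m - 1)" using two(2) by simp
    ultimately have "m dvd p" by (simp add: coprime_dvd_mult_left_iff)
    then obtain q where p: "p = q * m" unfolding dvd_def by (auto simp: mult.commute)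
    have "(q * (m - 1)) * m = (n - 3) * m" using two(2) p by (simp add: mult_ac)
    then have q: "q * (m - 1) = n - 3" using two(1) by simp
    \<comment> \<open>Since \<open>p = q m = n - 3 + q\<close>, this bounds \<open>q\<close> by
      3.\<close>
    have "p \<le> n"
    proof -
      have "card {u \<in> pverts G. card (part G u) = m} \<le> card (pverts G)"
        using pair_graph_facts(1)[OF G(1)] by (intro card_mono) auto
      then show ?thesis using two(3) by (simp add: uniform_multipartite_def)
    qed
    moreover have qm: "q * m = q * (m - 1) + q" using two(1) by (cases m) auto
    ultimately have "q \<le> 3" using p q n by simp
    moreover have "q \<noteq> 0" using q n by (intro notI) simp
    ultimately have "q = 1 \<or> q = 2 \<or> q = 3" by auto
    then show ?rhs
    proof (elim disjE)
      assume "q = 1"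
      then have "m = n - 2" "p = n - 2" using q p n two(1) by auto
      then show ?rhs using two(3) by simp
    next
      assume "q = 2"
      then have *: "2 * (m - 1) = n - 3" "p = 2 * m" using q p by auto
      then have "n = 2 * m + 1" using n two(1) by simp
      then have "odd n" "m = (n - 1) div 2" "p = n - 1" using *(2) by auto
      then show ?rhs using two(3) by simp
    next
      assume "q = 3"
      then have *: "3 * (m - 1) = n - 3" "p = 3 * m" using q p by auto
      then have "n = 3 * m" using n two(1) by simp
      then have "3 dvd n" "m = n div 3" "p = n" using *(2) by auto
      then show ?rhs using two(3) by simp
    qed
  qed (use ab in simp)
next
  assume ?rhs
  then obtain m p where mp: "m \<ge> 2" "m < n" "p * (m - 1) = (n - 3) * m" and G: "uniform_multipartite G n m p"
  proof (elim disjE conjE)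
    assume "uniform_multipartite G n (n - 2) (n - 2)"
    moreover have "n - 2 - 1 = n - 3" by simp
    ultimately show thesis using that[of "n - 2" "n - 2"] n by simp
  next
    assume "odd n" and G: "uniform_multipartite G n ((n - 1) div 2) (n - 1)"
    from \<open>odd n\<close> obtain h where h: "n = 2 * h + 1" by (elim oddE)
    have "2 * h * (h - 1) = (2 * h + 1 - 3) * h" by (simp add: algebra_simps diff_mult_distrib2)
    then show thesis using that[of h "2 * h"] G n by (simp add: h)
  next
    assume "3 dvd n" and G: "uniform_multipartite G n (n div 3) n"
    from \<open>3 dvd n\<close> obtain h where h: "n = 3 * h" by (elim dvdE)
    have "3 * h * (h - 1) = (3 * h - 3) * h" by (simp add: algebra_simps diff_mult_distrib2)
    then show thesis using that[of h "3 * h"] G n by (simp add: h)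
  qed
  have "laplacian_spectrum G = replicate_mset 2 (real n) + replicate_mset (n - 3) (real n - real m) + {#0#}"
    by (rule laplacian_spectrum_uniform_multipartite[OF G mp]) (use n in auto)
  moreover have "real n > real n - real m" "real n - real m > 0" using mp by auto
  moreover have "connected_graph_on n G"
    using uniform_multipartite_connected[OF G] mp G unfolding connected_graph_on_def uniform_multipartite_def by auto
  ultimately show "G \<in> G2_class n" unfolding G2_class_def by blast
qed

theorem theorem3p2:
  fixes n :: nat
  assumes "n \<ge> 6"
  shows
    "(\<forall>G :: 'a pair_pre_digraph. G \<in> G1_class n \<longleftrightarrow>
        digraph_iso G (edgeless_pgraph 3 \<nabla> complete_pgraph (n - 3)) \<or>
        digraph_iso G (cycle_pgraph 4 \<nabla> complete_pgraph (n - 4)))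
     \<and> laplacian_spectrum (edgeless_pgraph 3 \<nabla> complete_pgraph (n - 3))
         = replicate_mset (n - 3) (real n) + replicate_mset 2 (real n - 3) + {#0#}
     \<and> laplacian_spectrum (cycle_pgraph 4 \<nabla> complete_pgraph (n - 4))
         = replicate_mset (n - 3) (real n) + replicate_mset 2 (real n - 2) + {#0#}
     \<and> (\<forall>G :: 'a pair_pre_digraph. G \<in> G2_class n \<longleftrightarrow>
        digraph_iso G (complete_pgraph 2 \<nabla> edgeless_pgraph (n - 2)) \<or>
        (odd n \<and> digraph_iso G
           (complete_pgraph 1 \<nabla> complete_multipartite_pgraph [(n - 1) div 2, (n - 1) div 2])) \<or>
        (3 dvd n \<and> digraph_iso G
           (complete_multipartite_pgraph [n div 3, n div 3, n div 3])))
     \<and> laplacian_spectrum (complete_pgraph 2 \<nabla> edgeless_pgraph (n - 2))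
         = replicate_mset 2 (real n) + replicate_mset (n - 3) 2 + {#0#}
     \<and> (odd n \<longrightarrow>
        laplacian_spectrum
          (complete_pgraph 1 \<nabla> complete_multipartite_pgraph [(n - 1) div 2, (n - 1) div 2])
         = replicate_mset 2 (real n) + replicate_mset (n - 3) ((real n + 1) / 2) + {#0#})
     \<and> (3 dvd n \<longrightarrow>
        laplacian_spectrum (complete_multipartite_pgraph [n div 3, n div 3, n div 3])
         = replicate_mset 2 (real n) + replicate_mset (n - 3) (2 * real n / 3) + {#0#})"
proof -
  \<comment> \<open>Each listed graph is placed by its triple: order, size of the large parts,
    number of vertices in them. The complete factor of a join contributes the singleton
    parts.\<close>
  have G1: "uniform_multipartite (edgeless_pgraph 3 \<nabla> complete_pgraph (n - 3)) n 3 3"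
    using uniform_multipartite_join[OF uniform_multipartite_edgeless[of 3] uniform_multipartite_complete[of 3 "n - 3"]] assms
    by simp
  have G2: "uniform_multipartite (cycle_pgraph 4 \<nabla> complete_pgraph (n - 4)) n 2 4"
    using uniform_multipartite_join[OF uniform_multipartite_cycle_4 uniform_multipartite_complete[of 2 "n - 4"]] assms
    by simp
  have G3: "uniform_multipartite (complete_pgraph 2 \<nabla> edgeless_pgraph (n - 2)) n (n - 2) (n - 2)"
  proof -
    have m: "n - 2 \<ge> 2" "2 + (n - 2) = n" using assms by auto
    from uniform_multipartite_join[OF uniform_multipartite_complete[OF m(1), of 2] uniform_multipartite_edgeless]
    show ?thesis unfolding m(2) add_0 .
  qed
  have G4: "uniform_multipartite
      (complete_pgraph 1 \<nabla> complete_multipartite_pgraph [(n - 1) div 2, (n - 1) div 2]) n ((n - 1) div 2) (n - 1)"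
    if odd: "odd n"
  proof -
    define h where "h = (n - 1) div 2"
    obtain k where k: "n = 2 * k + 1" using odd by (elim oddE)
    have "h = k" unfolding h_def k by simp
    then have h: "h \<ge> 2" "2 * h = n - 1" "1 + (n - 1) = n" using assms k by linarith+
    have rep: "replicate 2 h = [h, h]" by (simp add: numeral_2_eq_2)
    from uniform_multipartite_join[OF uniform_multipartite_complete[OF h(1), of 1]
        uniform_multipartite_complete_multipartite[of 2 h]]
    show ?thesis unfolding rep h(2,3) add_0 unfolding h_def .
  qed
  have G5: "uniform_multipartite (complete_multipartite_pgraph [n div 3, n div 3, n div 3]) n (n div 3) n"
    if "3 dvd n"
  proof -
    have rep: "replicate 3 h = [h, h, h]" for h :: nat by (simp add: numeral_3_eq_3)
    have n: "3 * (n div 3) = n" using that by (rule dvd_mult_div_cancel)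
    show ?thesis using uniform_multipartite_complete_multipartite[of 3 "n div 3"] unfolding rep n .
  qed
  note spec = laplacian_spectrum_uniform_multipartite
  show ?thesis
  proof (intro conjI allI impI)
    fix G :: "'a pair_pre_digraph"
    show "G \<in> G1_class n \<longleftrightarrow>
        digraph_iso G (edgeless_pgraph 3 \<nabla> complete_pgraph (n - 3)) \<or>
        digraph_iso G (cycle_pgraph 4 \<nabla> complete_pgraph (n - 4))"
      by (simp add: G1_class_iff[OF assms] digraph_iso_uniform_multipartite_iff[OF G1]
          digraph_iso_uniform_multipartite_iff[OF G2])
    have le: "(n - 1) div 2 \<ge> 2" "n div 3 \<ge> 2" "n - 2 \<ge> 2" using assms by auto
    show "G \<in> G2_class n \<longleftrightarrow>
        digraph_iso G (complete_pgraph 2 \<nabla> edgeless_pgraph (n - 2)) \<or>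
        (odd n \<and> digraph_iso G
           (complete_pgraph 1 \<nabla> complete_multipartite_pgraph [(n - 1) div 2, (n - 1) div 2])) \<or>
        (3 dvd n \<and> digraph_iso G
           (complete_multipartite_pgraph [n div 3, n div 3, n div 3]))"
      \<comment> \<open>\<open>G4\<close> and \<open>G5\<close> hold only under the divisibility
        guards; \<open>conj_cong\<close> makes each guard available while its conjunct is
        rewritten.\<close>
      unfolding G2_class_iff[OF assms] digraph_iso_uniform_multipartite_iff[OF G3 le(3)]
      by (intro disj_cong conj_cong refl digraph_iso_uniform_multipartite_iff[OF G4 le(1), symmetric]
          digraph_iso_uniform_multipartite_iff[OF G5 le(2), symmetric])
  next
    show "laplacian_spectrum (edgeless_pgraph 3 \<nabla> complete_pgraph (n - 3))
        = replicate_mset (n - 3) (real n) + replicate_mset 2 (real n - 3) + {#0#}"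
      using spec[OF G1, of 2 "n - 3"] assms by simp
    show "laplacian_spectrum (cycle_pgraph 4 \<nabla> complete_pgraph (n - 4))
        = replicate_mset (n - 3) (real n) + replicate_mset 2 (real n - 2) + {#0#}"
      using spec[OF G2, of 2 "n - 3"] assms by simp
    \<comment> \<open>The trace identity \<open>p (m - 1) = l m\<close> for a single large part:
      \<open>p = m = n - 2\<close> and \<open>l = n - 3\<close>.\<close>
    have part: "(n - 2) * (n - 2 - 1) = (n - 3) * (n - 2)" by simp
    have eig: "real n - real (n - 2) = 2" using assms by (simp add: of_nat_diff)
    show "laplacian_spectrum (complete_pgraph 2 \<nabla> edgeless_pgraph (n - 2))
        = replicate_mset 2 (real n) + replicate_mset (n - 3) 2 + {#0#}"
      by (rule spec[OF G3 _ _ part, of 2, unfolded eig]) (use assms in auto)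
  next
    assume "odd n"
    then obtain h where h: "n = 2 * h + 1" by (elim oddE)
    then have "(n - 1) div 2 = h" "n - 1 = 2 * h" "n - 3 = 2 * (h - 1)" by auto
    then have part: "(n - 1) * ((n - 1) div 2 - 1) = (n - 3) * ((n - 1) div 2)"
      by (simp only: mult_ac)
    have eig: "real n - real ((n - 1) div 2) = (real n + 1) / 2" by (simp add: h)
    show "laplacian_spectrum
          (complete_pgraph 1 \<nabla> complete_multipartite_pgraph [(n - 1) div 2, (n - 1) div 2])
         = replicate_mset 2 (real n) + replicate_mset (n - 3) ((real n + 1) / 2) + {#0#}"
      by (rule spec[OF G4[OF \<open>odd n\<close>] _ _ part, of 2, unfolded eig]) (use assms in auto)
  next
    assume "3 dvd n"
    then obtain h where h: "n = 3 * h" by (elim dvdE)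
    then have "n div 3 = h" "n - 3 = 3 * (h - 1)" by auto
    then have part: "n * (n div 3 - 1) = (n - 3) * (n div 3)"
      by (simp only: h mult_ac)
    have eig: "real n - real (n div 3) = 2 * real n / 3" by (simp add: h)
    show "laplacian_spectrum (complete_multipartite_pgraph [n div 3, n div 3, n div 3])
         = replicate_mset 2 (real n) + replicate_mset (n - 3) (2 * real n / 3) + {#0#}"
      by (rule spec[OF G5[OF \<open>3 dvd n\<close>] _ _ part, of 2, unfolded eig]) (use assms in auto)
  qed
qed

end
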